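(* Fix $r\ge1$ and let $P=\sum_{k\ge0}p_k\bar z^{\,k}$, where $p_k=\sum_{n\ge0}p_n^{(k)}x^n$ and $p_n^{(k)}$ is the number of two-stack-sortable $k$-tuple $r$-permutations of $[n]$ with components allowed to be empty. Let $y$ be the formal power series in $x$ with zero constant term determined by $x=\frac{y}{(1+y)^{2r+1}}$, let $t=y(1+y)\frac{\bar z}{1-\bar z}$ and $c(t)=\frac{1-\sqrt{1-4t}}{2t}$. Then $$P=\left(1+\frac{t}{y(1+y)}\right)\frac{c(t)(1+y)^{r+1}}{(1+y\,c(t))^{r+1}}.$$
   Context: An $r$-permutation of a finite set $A$ of positive integers is a word in which each element of $A$ appears exactly $r$ times such that whenever $i<j<k$ and $a_i=a_k$ we have $a_j\le a_i$. A $k$-tuple $r$-permutation of $[n]$ is a tuple $(\alpha_1,\dots,\alpha_k)$ of words whose concatenation is an $r$-permutation of $[n]$ and in which every letter appears in only one $\alpha_i$. Stack sorting $S$: on words with distinct letters, $S(\emptyset)=\emptyset$ and $S(\pi_lm\pi_r)=S(\pi_l)S(\pi_r)m$ with $m$ the largest letter; on a nonempty $r$-permutation with largest letter $m$, written $\alpha_1m\alpha_2m\cdots m\alpha_{r+1}$, $S(\pi)=S(\alpha_1)\cdots S(\alpha_{r+1})m$; $S(\emptyset)=\emptyset$. The tuple is two-stack-sortable if $S(S(\alpha_1)\cdots S(\alpha_k))=12\cdots n$. *)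

theory Defs
  imports "HOL-Computational_Algebra.Computational_Algebra"
begin

definition r_permutation :: "nat \<Rightarrow> nat set \<Rightarrow> nat list \<Rightarrow> bool" where
  "r_permutation r A w \<longleftrightarrow>
     set w \<subseteq> A \<and> (\<forall>a\<in>A. count_list w a = r) \<and>
     (\<forall>i j k. i < j \<longrightarrow> j < k \<longrightarrow> k < length w \<longrightarrow> w ! i = w ! k \<longrightarrow> w ! j \<le> w ! i)"

definition tuple_r_permutation :: "nat \<Rightarrow> nat \<Rightarrow> nat \<Rightarrow> nat list list \<Rightarrow> bool" where
  "tuple_r_permutation k r n \<alpha>s \<longleftrightarrow>
     length \<alpha>s = k \<and> r_permutation r {1..n} (concat \<alpha>s) \<and>
     (\<forall>i<k. \<forall>j<k. i \<noteq> j \<longrightarrow> set (\<alpha>s ! i) \<inter> set (\<alpha>s ! j) = {})"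

text \<open>
  \<open>split_on m w\<close> cuts \<open>w\<close> at every occurrence of \<open>m\<close>: a word \<open>\<alpha>\<^sub>1 m \<alpha>\<^sub>2 m \<dots> m \<alpha>\<^sub>s\<close>, with
  no \<open>m\<close> in any \<open>\<alpha>\<^sub>i\<close>, gives \<open>[\<alpha>\<^sub>1, \<dots>, \<alpha>\<^sub>s]\<close>; some of the \<open>\<alpha>\<^sub>i\<close> may be empty.
\<close>

fun split_on :: "'a \<Rightarrow> 'a list \<Rightarrow> 'a list list" where
  "split_on m [] = [[]]"
| "split_on m (x # xs) =
     (if x = m then [] # split_on m xs
      else (x # hd (split_on m xs)) # tl (split_on m xs))"

lemma split_on_not_Nil [simp]: "split_on m w \<noteq> []"
  by (cases w) auto

lemma split_on_no_occ: "m \<notin> set w \<Longrightarrow> split_on m w = [w]"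
  by (induction w) auto

lemma split_on_append: "m \<notin> set u \<Longrightarrow> split_on m (u @ m # v) = u # split_on m v"
  by (induction u) auto

lemma split_on_length_le: "u \<in> set (split_on m w) \<Longrightarrow> length u \<le> length w"
proof (induction w arbitrary: u)
  case (Cons x xs)
  show ?case
  proof (cases "x = m")
    case True
    then show ?thesis using Cons by fastforce
  next
    case False
    then have "u = x # hd (split_on m xs) \<or> u \<in> set (tl (split_on m xs))"
      using Cons.prems by auto
    then show ?thesis
      using Cons.IH[of u] Cons.IH[of "hd (split_on m xs)"]
        list.set_sel(1)[of "split_on m xs"] list.set_sel(2)[of "split_on m xs" u]
      by auto
  qed
qed simp

lemma split_on_length_less:
  assumes "m \<in> set w" "u \<in> set (split_on m w)"
  shows "length u < length w"
proof -
  obtain a b where ab: "w = a @ m # b" "m \<notin> set a"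
    using assms(1) by (meson split_list_first)
  then have "u = a \<or> u \<in> set (split_on m b)"
    using assms(2) by (auto simp: split_on_append)
  then show ?thesis
    using split_on_length_le[of u m b] ab by auto
qed

text \<open>
  Stack sorting is one function on all words. On words with distinct letters the largest
  letter occurs once and on \<open>r\<close>-permutations it occurs \<open>r\<close> times, so both recursions
  below are instances of it.
\<close>

function (sequential) stack_sort :: "nat list \<Rightarrow> nat list" where
  "stack_sort [] = []"
| "stack_sort (x # xs) =
     (let w = x # xs; m = Max (set w)
      in concat (map stack_sort (split_on m w)) @ [m])"
  by pat_completeness auto
termination
proof (relation "measure length", goal_cases)
  case 1
  show ?case by simp
next
  case (2 x xs w m u)
  have "m \<in> set w"
    unfolding 2(2) using 2(1) by (intro Max_in) auto
  from split_on_length_less[OF this 2(3)] show ?case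
    using 2(1) by simp
qed

declare stack_sort.simps(2) [simp del]

lemma stack_sort_nonempty:
  "w \<noteq> [] \<Longrightarrow>
     stack_sort w = concat (map stack_sort (split_on (Max (set w)) w)) @ [Max (set w)]"
  by (cases w) (auto simp: stack_sort.simps(2) Let_def)

lemma stack_sort_distinct:
  assumes "\<And>x. x \<in> set \<pi>\<^sub>l \<union> set \<pi>\<^sub>r \<Longrightarrow> x < m"
  shows "stack_sort (\<pi>\<^sub>l @ m # \<pi>\<^sub>r) = stack_sort \<pi>\<^sub>l @ stack_sort \<pi>\<^sub>r @ [m]"
proof -
  have "Max (set (\<pi>\<^sub>l @ m # \<pi>\<^sub>r)) = m"
    using assms by (intro Max_eqI) (auto simp: less_imp_le)
  moreover have "m \<notin> set \<pi>\<^sub>l" "m \<notin> set \<pi>\<^sub>r"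
    using assms by auto
  ultimately show ?thesis
    by (simp add: stack_sort_nonempty split_on_append split_on_no_occ)
qed

lemma stack_sort_multi:
  assumes "\<beta>s \<noteq> []" and "\<And>\<beta> x. \<beta> \<in> set (\<alpha> # \<beta>s) \<Longrightarrow> x \<in> set \<beta> \<Longrightarrow> x < m"
  shows "stack_sort (\<alpha> @ concat (map (\<lambda>\<beta>. m # \<beta>) \<beta>s)) =
           concat (map stack_sort (\<alpha> # \<beta>s)) @ [m]"
proof -
  let ?w = "\<alpha> @ concat (map (\<lambda>\<beta>. m # \<beta>) \<beta>s)"
  have split: "split_on m (a @ concat (map (\<lambda>\<beta>. m # \<beta>) bs)) = a # bs"
    if "\<forall>\<beta>\<in>set (a # bs). m \<notin> set \<beta>" for a bs
    using that
    by (induction bs arbitrary: a) (auto simp: split_on_append split_on_no_occ)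
  have "Max (set ?w) = m"
  proof (intro Max_eqI)
    show "y \<le> m" if "y \<in> set ?w" for y
    proof -
      have "y = m \<or> (\<exists>\<beta>\<in>set (\<alpha> # \<beta>s). y \<in> set \<beta>)"
        using that by (auto split: if_splits)
      then show ?thesis
        using assms(2)[of _ y] by (metis less_imp_le order_refl)
    qed
    show "m \<in> set ?w" using assms(1) by (cases \<beta>s) auto
  qed simp
  moreover have "\<forall>\<beta>\<in>set (\<alpha> # \<beta>s). m \<notin> set \<beta>"
    using assms(2) by blast
  moreover have "?w \<noteq> []" using assms(1) by (cases \<beta>s) auto
  ultimately show ?thesis
    using split[of \<alpha> \<beta>s] stack_sort_nonempty[of ?w] by metis
qed

definition two_stack_sortable :: "nat \<Rightarrow> nat list list \<Rightarrow> bool" where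
  "two_stack_sortable n \<alpha>s \<longleftrightarrow>
     stack_sort (concat (map stack_sort \<alpha>s)) = [1..<Suc n]"

definition p_coeff :: "nat \<Rightarrow> nat \<Rightarrow> nat \<Rightarrow> nat" where
  "p_coeff r k n = card {\<alpha>s. tuple_r_permutation k r n \<alpha>s \<and> two_stack_sortable n \<alpha>s}"

lemma finite_tuple_r_permutation: "finite {\<alpha>s. tuple_r_permutation k r n \<alpha>s}"
proof -
  let ?W = "{w. set w \<subseteq> {1..n} \<and> length w \<le> n * r}"
  have "{\<alpha>s. tuple_r_permutation k r n \<alpha>s} \<subseteq> {\<alpha>s. set \<alpha>s \<subseteq> ?W \<and> length \<alpha>s = k}"
  proof safe
    fix \<alpha>s assume *: "tuple_r_permutation k r n \<alpha>s"
    then have A: "set (concat \<alpha>s) \<subseteq> {1..n}" "\<forall>a\<in>{1..n}. count_list (concat \<alpha>s) a = r"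
      unfolding tuple_r_permutation_def r_permutation_def by blast+
    have "length (concat \<alpha>s) = (\<Sum>a\<in>set (concat \<alpha>s). count_list (concat \<alpha>s) a)"
      by (simp add: sum_count_set)
    also have "\<dots> \<le> (\<Sum>a\<in>{1..n}. count_list (concat \<alpha>s) a)"
      using A(1) by (intro sum_mono2) auto
    also have "\<dots> = n * r"
      using A(2) by simp
    finally have L: "length (concat \<alpha>s) \<le> n * r" .
    show "length \<alpha>s = k"
      using * by (simp add: tuple_r_permutation_def)
    fix w assume w: "w \<in> set \<alpha>s"
    have "length w \<le> length (concat \<alpha>s)"
      using w by (auto simp: length_concat intro!: member_le_sum_list)
    then show "length w \<le> n * r" using L by simp
    fix x assume "x \<in> set w"
    then show "x \<in> {1..n}" using A(1) w by auto
  qed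
  moreover have "finite ?W"
    using finite_lists_length_le[of "{1..n}" "n * r"] by simp
  ultimately show ?thesis
    using finite_lists_length_eq[of ?W k] by (blast intro: finite_subset)
qed

text \<open>
  Power series in \<open>z\<close> (standing for \<open>\<bar>z\<close>) have coefficients in the field of
  Laurent series in \<open>x\<close>, so that division by the non-unit \<open>y (1 + y)\<close> is genuine. Dividing in
  \<^typ>\<open>rat fps fps\<close> instead would give \<open>0\<close>, because \<open>inverse\<close> of a power series with zero
  constant term is \<open>0\<close>.
\<close>

definition x_series :: "rat fps \<Rightarrow> rat fls fps" where
  "x_series f = fps_const (fps_to_fls f)"

definition P_series :: "nat \<Rightarrow> rat fls fps" where
  "P_series r = Abs_fps (\<lambda>k. fps_to_fls (Abs_fps (\<lambda>n. of_nat (p_coeff r k n))))"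

text \<open>
  The square root of a series with constant term \<open>1\<close> is the one with constant term \<open>1\<close>;
  the first argument of \<^const>\<open>fps_radical\<close> supplies that constant term.
\<close>

definition sqrt_series :: "'a::field_char_0 fps \<Rightarrow> 'a fps" where
  "sqrt_series f = fps_radical (\<lambda>_ _. 1) 2 f"

lemma sqrt_series_unique:
  assumes "fps_nth f 0 = 1"
  shows "s = sqrt_series f \<longleftrightarrow> s ^ 2 = f \<and> fps_nth s 0 = 1"
proof -
  have iff: "a ^ Suc 1 = f \<longleftrightarrow> a = fps_radical (\<lambda>_ _. 1) (Suc 1) f" if "fps_nth a 0 = 1" for a
    using assms that by (intro radical_unique) auto
  have "fps_nth (sqrt_series f) 0 = 1"
    by (simp add: sqrt_series_def)
  then show ?thesis
    using iff[of s] iff[of "sqrt_series f"]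
    by (auto simp: sqrt_series_def numeral_2_eq_2 simp del: power_Suc)
qed

definition c_series :: "'a::field_char_0 fps \<Rightarrow> 'a fps" where
  "c_series t = (1 - sqrt_series (1 - 4 * t)) / (2 * t)"

lemma y_series_exists_unique:
  "\<exists>!y :: rat fps. fps_nth y 0 = 0 \<and> fps_X = y / (1 + y) ^ (2 * r + 1)"
proof -
  define g :: "rat fps" where "g = (1 + fps_X) ^ (2 * r + 1)"
  define f :: "rat fps" where "f = fps_X / g"
  have g0: "fps_nth g 0 = 1"
    by (simp add: g_def fps_power_zeroth)
  have fg: "f = fps_X * inverse g"
    using g0 by (simp add: f_def fps_divide_unit)
  have f: "fps_nth f 0 = 0" "fps_nth f 1 \<noteq> 0"
    using g0 by (simp_all add: fg)
  have comp: "f oo y = y / (1 + y) ^ (2 * r + 1)" if y0: "fps_nth y 0 = 0" for y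
  proof -
    have gy: "g oo y = (1 + y) ^ (2 * r + 1)"
      unfolding g_def fps_compose_power[OF y0, symmetric] fps_compose_add_distrib
      using y0 by (simp del: power_Suc)
    have "g oo y \<noteq> 0"
      using g0 by (metis fps_compose_nth_0 fps_zero_nth zero_neq_one)
    moreover have "g dvd fps_X"
      by (rule unit_imp_dvd) (use g0 in \<open>simp only: fps_is_unit_iff; simp\<close>)
    ultimately have "f oo y = (fps_X oo y) / (g oo y)"
      unfolding f_def by (intro fps_compose_divide_distrib y0)
    then show ?thesis
      using y0 by (simp only: gy fps_X_fps_compose_startby0)
  qed
  show ?thesis
  proof (rule ex1I[of _ "fps_inv f"])
    have i0: "fps_nth (fps_inv f) 0 = 0"
      by (simp add: fps_inv_def)
    show "fps_nth (fps_inv f) 0 = 0 \<and> fps_X = fps_inv f / (1 + fps_inv f) ^ (2 * r + 1)"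
      using i0 by (simp only: comp[OF i0, symmetric] fps_inv_right[OF f])
  next
    fix y :: "rat fps"
    assume y: "fps_nth y 0 = 0 \<and> fps_X = y / (1 + y) ^ (2 * r + 1)"
    then have y0: "fps_nth y 0 = 0" by blast
    have "y = (fps_inv f oo f) oo y"
      using y0 by (simp only: fps_inv[OF f] fps_X_fps_compose_startby0)
    also have "\<dots> = fps_inv f oo (f oo y)"
      using fps_compose_assoc[OF y0 f(1)] by simp
    also have "f oo y = fps_X"
      using y comp[OF y0] by metis
    finally show "y = fps_inv f" by simp
  qed
qed

end

theory Submission
  imports Defs
begin

text \<open>
  Removing the \<open>r\<close> copies of the largest letter from the component \<open>\<alpha>\<^sub>i\<close> that contains them splits
  that component into \<open>r + 1\<close> words. The tuple is two-stack-sortable iff the words up to this point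
  and the remaining components both are, on consecutive intervals of letters, so that
  \<open>p\<^sub>k = 1 + x (\<Sum>i=1..k. p\<^sub>i\<^sub>+\<^sub>r p\<^sub>k\<^sub>-\<^sub>i)\<close>. This recurrence determines all \<open>p\<^sub>k\<close>.

  To see that the coefficients of the closed form \<open>Q\<close> satisfy it, put \<open>u = 1 / c(t)\<close>, \<open>u' = 1 - u\<close>,
  \<open>v = u / (u + y)\<close> and \<open>v' = u' / (u' + y)\<close>. Then \<open>v v' = z\<close>, while \<open>v + v'\<close> is linear in \<open>z\<close>, so
  \<open>A\<^sub>n = (u' + y) v\<^sup>n + (u + y) v'\<^sup>n\<close> is a polynomial in \<open>z\<close> of degree at most \<open>n\<close>. Since
  \<open>Q = (1 + y)\<^bsup>r+1\<^esup> v\<^sup>r / ((1 - z) (u + y))\<close>, this gives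
  \<open>z\<^sup>r (Q - 1 / (1 - z)) = x Q (Q - T)\<close> with \<open>T\<close> of degree at most \<open>r\<close>. The left-hand side is divisible by
  \<open>z\<^bsup>r+1\<^esup>\<close>, hence \<open>T\<close> is the truncation of \<open>Q\<close>, and this is the recurrence.
\<close>

section \<open>Removing the largest letter\<close>

text \<open>Recursion on the word, instead of index triples, makes concatenations accessible to
  induction: \<open>dropWhile\<close> discards everything before the first letter larger than
  \<open>x\<close>, so the test forbids a return of \<open>x\<close> after it.
  \<open>nested_iff\<close> recovers the indexed form.\<close>

fun nested :: "nat list \<Rightarrow> bool" where
  "nested [] = True"
| "nested (x # xs) \<longleftrightarrow> x \<notin> set (dropWhile (\<lambda>y. y \<le> x) xs) \<and> nested xs"

lemma not_in_set_dropWhile_iff: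
  "x \<notin> set (dropWhile P xs) \<longleftrightarrow> (\<forall>j k. j \<le> k \<longrightarrow> k < length xs \<longrightarrow> xs ! k = x \<longrightarrow> P (xs ! j))"
proof (induction xs)
  case (Cons a xs)
  have split: "(\<forall>j k. j \<le> k \<longrightarrow> k < length (a # xs) \<longrightarrow> (a # xs) ! k = x \<longrightarrow> P ((a # xs) ! j))
     \<longleftrightarrow> (a = x \<longrightarrow> P a) \<and> (\<forall>k < length xs. xs ! k = x \<longrightarrow> P a) \<and>
       (\<forall>j k. j \<le> k \<longrightarrow> k < length xs \<longrightarrow> xs ! k = x \<longrightarrow> P (xs ! j))" (is "?L \<longleftrightarrow> ?R")
  proof
    assume L: ?L
    show ?R
    proof (intro conjI allI impI)
      show "P a" if "a = x" using L[rule_format, of 0 0] that by simp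
      show "P a" if "k < length xs" "xs ! k = x" for k
        using L[rule_format, of 0 "Suc k"] that by simp
      show "P (xs ! j)" if "j \<le> k" "k < length xs" "xs ! k = x" for j k
        using L[rule_format, of "Suc j" "Suc k"] that by simp
    qed
  next
    assume R: ?R
    show ?L
    proof (intro allI impI)
      fix j k assume "j \<le> k" "k < length (a # xs)" "(a # xs) ! k = x"
      then show "P ((a # xs) ! j)"
        using R by (cases j; cases k) auto
    qed
  qed
  show ?case
  proof (cases "P a")
    case True
    then show ?thesis unfolding split using Cons.IH by auto
  next
    case False
    then show ?thesis unfolding split
      by (auto simp: in_set_conv_nth)
  qed
qed simp

lemma nested_iff:
  "nested w \<longleftrightarrow> (\<forall>i j k. i < j \<longrightarrow> j < k \<longrightarrow> k < length w \<longrightarrow> w ! i = w ! k \<longrightarrow> w ! j \<le> w ! i)"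
proof (induction w)
  case (Cons a w)
  let ?L = "\<forall>i j k. i < j \<longrightarrow> j < k \<longrightarrow> k < length (a # w) \<longrightarrow> (a # w) ! i = (a # w) ! k
    \<longrightarrow> (a # w) ! j \<le> (a # w) ! i"
  let ?R = "\<forall>j k. j \<le> k \<longrightarrow> k < length w \<longrightarrow> w ! k = a \<longrightarrow> w ! j \<le> a"
  have "?L \<longleftrightarrow> ?R \<and> nested w"
  proof
    assume L: ?L
    have "w ! j \<le> a" if "j \<le> k" "k < length w" "w ! k = a" for j k
    proof (cases "j = k")
      case False
      then show ?thesis
        using L[rule_format, of 0 "Suc j" "Suc k"] that by simp
    qed (use that in simp)
    moreover have "w ! j \<le> w ! i" if "i < j" "j < k" "k < length w" "w ! i = w ! k" for i j k
      using L[rule_format, of "Suc i" "Suc j" "Suc k"] that by simp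
    ultimately show "?R \<and> nested w" unfolding Cons.IH by blast
  next
    assume R: "?R \<and> nested w"
    show ?L
    proof (intro allI impI)
      fix i j k
      assume h: "i < j" "j < k" "k < length (a # w)" "(a # w) ! i = (a # w) ! k"
      obtain j' k' where jk: "j = Suc j'" "k = Suc k'"
        using h(1,2) by (metis Nat.lessE)
      show "(a # w) ! j \<le> (a # w) ! i"
      proof (cases i)
        case 0
        with h jk R[THEN conjunct1, rule_format, of j' k'] show ?thesis by simp
      next
        case (Suc i')
        with h jk R[unfolded Cons.IH] show ?thesis by auto
      qed
    qed
  qed
  then show ?case by (simp add: not_in_set_dropWhile_iff)
qed simp

text \<open>A violation has two equal outer letters, which must lie in the same factor, and a larger
  letter between them, hence in that factor too.\<close>

lemma nested_append_disjoint:
  "set u \<inter> set v = {} \<Longrightarrow> nested (u @ v) \<longleftrightarrow> nested u \<and> nested v"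
proof (induction u)
  case (Cons x u)
  then have "x \<notin> set (dropWhile (\<lambda>y. y \<le> x) v)"
    using set_dropWhileD by fastforce
  then have "x \<notin> set (dropWhile (\<lambda>y. y \<le> x) (u @ v)) \<longleftrightarrow> x \<notin> set (dropWhile (\<lambda>y. y \<le> x) u)"
    using Cons.prems set_dropWhileD[of x "\<lambda>y. y \<le> x" u]
    by (auto simp: dropWhile_append dropWhile_eq_Nil_conv[THEN iffD2])
  then show ?case using Cons by auto
qed simp

text \<open>A letter of \<open>u\<close> found again in \<open>v\<close> would enclose the larger
  letter \<open>m\<close>, whereas two copies of \<open>m\<close> enclose only letters of
  \<open>v\<close>, none of them larger.\<close>

lemma nested_append_max:
  assumes "\<forall>x\<in>set u. x < m" "\<forall>x\<in>set v. x \<le> m"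
  shows "nested (u @ m # v) \<longleftrightarrow> nested u \<and> nested v \<and> set u \<inter> set v = {}"
  using assms(1)
proof (induction u)
  case Nil
  then show ?case using assms(2) by (simp add: dropWhile_eq_Nil_conv[THEN iffD2])
next
  case (Cons x u)
  then have "\<not> m \<le> x" by simp
  then have "dropWhile (\<lambda>y. y \<le> x) (u @ m # v) = dropWhile (\<lambda>y. y \<le> x) u @ m # v"
    by (rule dropWhile_append3)
  then show ?case using Cons by auto
qed

text \<open>As the components share no letter, testing each of them agrees with testing the
  concatenation. The recursive form lets tuples be split and rejoined.\<close>

fun nested_tuple :: "nat list list \<Rightarrow> bool" where
  "nested_tuple [] = True"
| "nested_tuple (\<alpha> # \<alpha>s) \<longleftrightarrow>
     nested \<alpha> \<and> set \<alpha> \<inter> set (concat \<alpha>s) = {} \<and> nested_tuple \<alpha>s"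

lemma nested_tuple_append:
  "nested_tuple (\<alpha>s @ \<beta>s) \<longleftrightarrow>
     nested_tuple \<alpha>s \<and> nested_tuple \<beta>s \<and> set (concat \<alpha>s) \<inter> set (concat \<beta>s) = {}"
  by (induction \<alpha>s) auto

lemma nested_tuple_iff:
  "nested_tuple \<alpha>s \<longleftrightarrow> nested (concat \<alpha>s) \<and>
     (\<forall>i<length \<alpha>s. \<forall>j<length \<alpha>s. i \<noteq> j \<longrightarrow> set (\<alpha>s ! i) \<inter> set (\<alpha>s ! j) = {})"
proof (induction \<alpha>s)
  case (Cons \<alpha> \<alpha>s)
  let ?D = "\<lambda>\<alpha>s. \<forall>i<length \<alpha>s. \<forall>j<length \<alpha>s. i \<noteq> j \<longrightarrow> set (\<alpha>s ! i) \<inter> set (\<alpha>s ! j) = ({}::nat set)"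
  have "?D (\<alpha> # \<alpha>s) \<longleftrightarrow> set \<alpha> \<inter> set (concat \<alpha>s) = {} \<and> ?D \<alpha>s"
  proof
    assume D: "?D (\<alpha> # \<alpha>s)"
    have "set \<alpha> \<inter> set (\<alpha>s ! j) = {}" if "j < length \<alpha>s" for j
      using D[rule_format, of 0 "Suc j"] that by simp
    then have "set \<alpha> \<inter> set (concat \<alpha>s) = {}"
      by (fastforce simp: in_set_conv_nth)
    moreover have "?D \<alpha>s"
      using D[rule_format, of "Suc _" "Suc _"] by simp
    ultimately show "set \<alpha> \<inter> set (concat \<alpha>s) = {} \<and> ?D \<alpha>s" by blast
  next
    assume R: "set \<alpha> \<inter> set (concat \<alpha>s) = {} \<and> ?D \<alpha>s"
    then have "set \<alpha> \<inter> set (\<alpha>s ! j) = {}" if "j < length \<alpha>s" for j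
      using that by (auto dest: nth_mem)
    then show "?D (\<alpha> # \<alpha>s)"
      using R by (auto simp: nth_Cons split: nat.split)
  qed
  then show ?case using Cons.IH nested_append_disjoint by auto
qed simp

section \<open>Cutting a word at a letter and glueing the pieces back\<close>

definition join :: "nat \<Rightarrow> nat list list \<Rightarrow> nat list" where
  "join m \<beta>s = hd \<beta>s @ concat (map ((#) m) (tl \<beta>s))"

lemma join_Cons: "\<beta>s \<noteq> [] \<Longrightarrow> join m (\<beta> # \<beta>s) = \<beta> @ m # join m \<beta>s"
  by (cases \<beta>s) (auto simp: join_def)

lemma join_singleton [simp]: "join m [\<beta>] = \<beta>"
  by (simp add: join_def)

lemma join_split_on: "join m (split_on m w) = w"
proof (induction w)
  case (Cons x w)
  then show ?case
    by (cases "split_on m w") (auto simp: join_def)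
qed (simp add: join_def)

lemma split_on_join:
  "\<beta>s \<noteq> [] \<Longrightarrow> m \<notin> set (concat \<beta>s) \<Longrightarrow> split_on m (join m \<beta>s) = \<beta>s"
proof (induction \<beta>s)
  case (Cons \<beta> \<beta>s)
  then show ?case
    by (cases "\<beta>s = []") (auto simp: join_Cons split_on_append split_on_no_occ)
qed simp

lemma set_concat_split_on: "set (concat (split_on m w)) = set w - {m}"
proof (induction w)
  case (Cons x w)
  then show ?case by (cases "split_on m w") auto
qed simp

lemma length_split_on: "length (split_on m w) = Suc (count_list w m)"
proof (induction w)
  case (Cons x w)
  then show ?case by (cases "split_on m w") auto
qed simp

lemma set_join:
  "\<beta>s \<noteq> [] \<Longrightarrow> set (join m \<beta>s) = set (concat \<beta>s) \<union> (if length \<beta>s = 1 then {} else {m})"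
proof (induction \<beta>s)
  case (Cons \<beta> \<beta>s)
  then show ?case by (cases "\<beta>s = []") (auto simp: join_Cons)
qed simp

lemma count_list_join:
  "\<beta>s \<noteq> [] \<Longrightarrow> count_list (join m \<beta>s) a =
     count_list (concat \<beta>s) a + (if a = m then length \<beta>s - 1 else 0)"
proof (induction \<beta>s)
  case (Cons \<beta> \<beta>s)
  then show ?case by (cases "\<beta>s = []") (auto simp: join_Cons neq_Nil_conv)
qed simp

text \<open>Different pieces are separated by the larger letter \<open>m\<close>, so a letter common
  to two pieces would violate nesting. This is why removing the largest letter leaves a tuple
  again.\<close>

lemma nested_join:
  "\<beta>s \<noteq> [] \<Longrightarrow> \<forall>x\<in>set (concat \<beta>s). x < m \<Longrightarrow> nested (join m \<beta>s) \<longleftrightarrow> nested_tuple \<beta>s"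
proof (induction \<beta>s)
  case (Cons \<beta> \<beta>s)
  show ?case
  proof (cases "\<beta>s = []")
    case False
    have le: "\<forall>x\<in>set (join m \<beta>s). x \<le> m"
      using Cons.prems False by (auto simp: set_join less_imp_le)
    have "m \<notin> set \<beta>" using Cons.prems by auto
    then have "set \<beta> \<inter> set (join m \<beta>s) = set \<beta> \<inter> set (concat \<beta>s)"
      using False by (auto simp: set_join)
    moreover have "nested (join m \<beta>s) \<longleftrightarrow> nested_tuple \<beta>s"
      using Cons False by simp
    ultimately show ?thesis
      using False nested_append_max[of \<beta> m "join m \<beta>s"] le Cons.prems
      by (auto simp: join_Cons)
  qed simp
qed simp

section \<open>Stack sorting of glued and relabelled words\<close>

abbreviation stack_sorts :: "nat list list \<Rightarrow> nat list" where
  "stack_sorts \<alpha>s \<equiv> concat (map stack_sort \<alpha>s)"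

text \<open>Having at least two pieces guarantees that \<open>m\<close> really occurs, and it is
  then the maximum at which stack sorting cuts.\<close>

lemma stack_sort_join:
  assumes "length \<beta>s \<ge> 2" "\<forall>x\<in>set (concat \<beta>s). x < m"
  shows "stack_sort (join m \<beta>s) = stack_sorts \<beta>s @ [m]"
proof -
  obtain \<beta> \<gamma>s where "\<beta>s = \<beta> # \<gamma>s" "\<gamma>s \<noteq> []"
    using assms(1) by (cases \<beta>s; cases "tl \<beta>s") auto
  then show ?thesis
    using stack_sort_multi[of \<gamma>s \<beta> m] assms(2) by (fastforce simp: join_def)
qed

lemma set_stack_sort [simp]: "set (stack_sort w) = set w"
proof (induction "length w" arbitrary: w rule: less_induct)
  case less
  show ?case
  proof (cases "w = []")
    case False
    let ?m = "Max (set w)"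
    have m: "?m \<in> set w" using False by simp
    have "set (stack_sorts (split_on ?m w)) = set (concat (split_on ?m w))"
      using less split_on_length_less[OF m] by auto
    then show ?thesis
      using m by (auto simp: stack_sort_nonempty[OF False] set_concat_split_on simp del: set_concat)
  qed simp
qed

lemma split_on_map:
  "inj f \<Longrightarrow> split_on (f m) (map f w) = map (map f) (split_on m w)"
  by (induction w) (auto simp: inj_eq hd_map map_tl)

text \<open>Only the relative order of letters matters: a strictly increasing map carries the
  maximum to the maximum and commutes with cutting there.\<close>

lemma stack_sort_map:
  assumes "strict_mono f"
  shows "stack_sort (map f w) = map f (stack_sort w)"
proof (induction "length w" arbitrary: w rule: less_induct)
  case less
  show ?case
  proof (cases "w = []")
    case False
    let ?m = "Max (set w)"
    have m: "?m \<in> set w" using False by simp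
    have max: "Max (set (map f w)) = f ?m"
      using mono_Max_commute[OF strict_mono_mono[OF assms], of "set w"] False by simp
    have "stack_sorts (map (map f) (split_on ?m w)) = map f (stack_sorts (split_on ?m w))"
      using less split_on_length_less[OF m] by (auto simp: map_concat cong: map_cong)
    then show ?thesis
      using False stack_sort_nonempty[of w] stack_sort_nonempty[of "map f w"]
      by (simp add: max[simplified] split_on_map[OF strict_mono_imp_inj_on[OF assms]])
  qed simp
qed

text \<open>The offset \<open>a\<close> is there because removing the largest letter leaves one
  tuple on an initial interval and one on the interval above it. The sorted word fixes the letter
  set, as stack sorting keeps the set of letters.\<close>

definition sortable_tuples :: "nat \<Rightarrow> nat \<Rightarrow> nat \<Rightarrow> nat \<Rightarrow> nat list list set" where
  "sortable_tuples r k a n = {\<alpha>s. length \<alpha>s = k \<and> nested_tuple \<alpha>s \<and>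
     (\<forall>x\<in>{a<..a+n}. count_list (concat \<alpha>s) x = r) \<and>
     stack_sort (stack_sorts \<alpha>s) = [Suc a..<Suc (a + n)]}"

lemma sortable_tuplesD:
  assumes "\<alpha>s \<in> sortable_tuples r k a n"
  shows "set (concat \<alpha>s) = {a<..a+n}"
proof -
  have "set (concat \<alpha>s) = set (stack_sort (stack_sorts \<alpha>s))"
    by simp
  also have "\<dots> = {a<..a+n}"
    using assms by (auto simp: sortable_tuples_def)
  finally show ?thesis .
qed

lemma p_coeff_eq_card_sortable_tuples: "p_coeff r k n = card (sortable_tuples r k 0 n)"
proof -
  have "tuple_r_permutation k r n \<alpha>s \<and> two_stack_sortable n \<alpha>s \<longleftrightarrow> \<alpha>s \<in> sortable_tuples r k 0 n" for \<alpha>s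
  proof
    assume h: "tuple_r_permutation k r n \<alpha>s \<and> two_stack_sortable n \<alpha>s"
    then show "\<alpha>s \<in> sortable_tuples r k 0 n"
      by (auto simp: tuple_r_permutation_def r_permutation_def two_stack_sortable_def
        sortable_tuples_def nested_tuple_iff nested_iff simp del: upt_Suc)
  next
    assume h: "\<alpha>s \<in> sortable_tuples r k 0 n"
    have "{0<..0 + n} = {1..n}" by auto
    with h sortable_tuplesD[OF h]
    show "tuple_r_permutation k r n \<alpha>s \<and> two_stack_sortable n \<alpha>s"
      unfolding tuple_r_permutation_def r_permutation_def two_stack_sortable_def
        sortable_tuples_def nested_tuple_iff nested_iff by simp
  qed
  then show ?thesis by (simp add: p_coeff_def)
qed

lemma nested_map:
  assumes "strict_mono f"
  shows "nested (map f w) \<longleftrightarrow> nested w"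
  using assms by (auto simp: nested_iff strict_mono_less_eq strict_mono_eq)

lemma nested_tuple_map:
  assumes "strict_mono f"
  shows "nested_tuple (map (map f) \<alpha>s) \<longleftrightarrow> nested_tuple \<alpha>s"
proof (induction \<alpha>s)
  case (Cons \<alpha> \<alpha>s)
  have "f ` set \<alpha> \<inter> f ` set (concat \<alpha>s) = f ` (set \<alpha> \<inter> set (concat \<alpha>s))"
    using strict_mono_imp_inj_on[OF assms] by (metis image_Int)
  then have "set (map f \<alpha>) \<inter> set (concat (map (map f) \<alpha>s)) = f ` (set \<alpha> \<inter> set (concat \<alpha>s))"
    by (simp flip: map_concat)
  then show ?case
    using Cons by (simp add: nested_map[OF assms] del: set_concat)
qed simp

lemma card_sortable_tuples_shift:
  "card (sortable_tuples r k a n) = card (sortable_tuples r k 0 n)"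
proof -
  let ?f = "\<lambda>x::nat. x + a"
  let ?F = "map (map ?f)"
  have mono: "strict_mono ?f" by (simp add: strict_mono_def)
  have sort: "stack_sort (stack_sorts (?F \<alpha>s)) = map ?f (stack_sort (stack_sorts \<alpha>s))" for \<alpha>s
  proof -
    have "stack_sorts (?F \<alpha>s) = map ?f (stack_sorts \<alpha>s)"
      by (induction \<alpha>s) (auto simp: stack_sort_map[OF mono])
    then show ?thesis by (simp add: stack_sort_map[OF mono])
  qed
  have iff: "?F \<alpha>s \<in> sortable_tuples r k a n \<longleftrightarrow> \<alpha>s \<in> sortable_tuples r k 0 n" for \<alpha>s
  proof -
    have count: "count_list (concat (?F \<alpha>s)) (x + a) = count_list (concat \<alpha>s) x" for x
      using count_list_map_conv[of ?f "concat \<alpha>s" x] by (simp add: map_concat inj_def)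
    have "{a<..a+n} = ?f ` {0<..0+n}"
      using image_add_greaterThanAtMost[of a 0 n] by (simp add: add.commute)
    then have "(\<forall>x\<in>{a<..a+n}. count_list (concat (?F \<alpha>s)) x = r) \<longleftrightarrow>
        (\<forall>x\<in>{0<..0+n}. count_list (concat \<alpha>s) x = r)"
      by (simp only: ball_simps count)
    moreover have "[Suc a..<Suc (a + n)] = map ?f [Suc 0..<Suc (0 + n)]"
      by (rule nth_equalityI) (simp_all del: upt_Suc)
    moreover have "inj (map ?f)" by (simp add: inj_def)
    ultimately show ?thesis
      unfolding sortable_tuples_def mem_Collect_eq sort nested_tuple_map[OF mono]
      by (simp only: length_map inj_eq)
  qed
  have "sortable_tuples r k a n = ?F ` sortable_tuples r k 0 n"
  proof (intro equalityI subsetI)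
    fix \<alpha>s assume h: "\<alpha>s \<in> sortable_tuples r k a n"
    \<comment> \<open>All letters are at least \<open>a\<close>, so truncated subtraction of
      \<open>a\<close> undoes the shift.\<close>
    have "a \<le> x" if "\<alpha> \<in> set \<alpha>s" "x \<in> set \<alpha>" for \<alpha> x
    proof -
      have "x \<in> set (concat \<alpha>s)" using that by auto
      then show ?thesis unfolding sortable_tuplesD[OF h] by simp
    qed
    then have "?F (map (map (\<lambda>x. x - a)) \<alpha>s) = \<alpha>s"
      by (auto simp: o_def intro!: map_idI)
    then show "\<alpha>s \<in> ?F ` sortable_tuples r k 0 n"
      using iff h by (metis imageI)
  qed (use iff in auto)
  moreover have "inj ?F" by (simp add: inj_def)
  ultimately show ?thesis
    using card_image inj_on_subset by (metis subset_UNIV)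
qed

section \<open>Glueing in the new largest letter\<close>

definition insert_max :: "nat \<Rightarrow> nat \<Rightarrow> nat list list \<Rightarrow> nat list list \<Rightarrow> nat list list" where
  "insert_max N i \<alpha>s \<beta>s = take i \<alpha>s @ join N (drop i \<alpha>s) # \<beta>s"

text \<open>The first pass yields the output for \<open>\<alpha>s\<close>, then a single
  \<open>N\<close>, then the output for \<open>\<beta>s\<close>; the second pass cuts at
  \<open>N\<close> and treats the two sides independently.\<close>

lemma stack_sorts_insert_max:
  assumes "length \<alpha>s \<ge> i + 2" "\<forall>x\<in>set (concat \<alpha>s) \<union> set (concat \<beta>s). x < N"
  shows "stack_sort (stack_sorts (insert_max N i \<alpha>s \<beta>s)) =
    stack_sort (stack_sorts \<alpha>s) @ stack_sort (stack_sorts \<beta>s) @ [N]"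
proof -
  have "\<forall>x\<in>set (concat (drop i \<alpha>s)). x < N"
    using assms(2) by (auto dest: in_set_dropD)
  then have "stack_sort (join N (drop i \<alpha>s)) = stack_sorts (drop i \<alpha>s) @ [N]"
    using assms(1) by (intro stack_sort_join) auto
  moreover have "stack_sorts \<alpha>s = stack_sorts (take i \<alpha>s) @ stack_sorts (drop i \<alpha>s)"
    by (metis append_take_drop_id concat_append map_append)
  ultimately have "stack_sorts (insert_max N i \<alpha>s \<beta>s) = stack_sorts \<alpha>s @ N # stack_sorts \<beta>s"
    by (simp add: insert_max_def)
  moreover have "\<forall>x\<in>set (stack_sorts \<alpha>s) \<union> set (stack_sorts \<beta>s). x < N"
    using assms(2) by auto
  ultimately show ?thesis
    by (simp only: stack_sort_distinct)
qed

text \<open>\<open>nested_join\<close> handles the glued component, and \<open>N\<close> occurs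
  nowhere else, so it creates no letter shared with another component.\<close>

lemma nested_tuple_insert_max:
  assumes "length \<alpha>s \<ge> i + 2" "\<forall>x\<in>set (concat \<alpha>s) \<union> set (concat \<beta>s). x < N"
  shows "nested_tuple (insert_max N i \<alpha>s \<beta>s) \<longleftrightarrow> nested_tuple (\<alpha>s @ \<beta>s)"
proof -
  define \<gamma>s \<delta>s where "\<gamma>s = take i \<alpha>s" and "\<delta>s = drop i \<alpha>s"
  have \<alpha>s: "\<alpha>s = \<gamma>s @ \<delta>s" by (simp add: \<gamma>s_def \<delta>s_def)
  have ne: "\<delta>s \<noteq> []" using assms(1) by (simp add: \<delta>s_def)
  have lt: "\<forall>x\<in>set (concat \<delta>s). x < N" and
    notin: "N \<notin> set (concat \<gamma>s)" "N \<notin> set (concat \<beta>s)"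
    using assms(2) unfolding \<alpha>s by auto
  have disj: "set (join N \<delta>s) \<inter> set (concat \<beta>s) = set (concat \<delta>s) \<inter> set (concat \<beta>s)"
    "set (concat \<gamma>s) \<inter> set (join N \<delta>s) = set (concat \<gamma>s) \<inter> set (concat \<delta>s)"
    using notin ne by (auto simp: set_join simp del: set_concat)
  have insert: "insert_max N i \<alpha>s \<beta>s = \<gamma>s @ join N \<delta>s # \<beta>s"
    by (simp add: insert_max_def \<gamma>s_def \<delta>s_def)
  have "nested_tuple (\<gamma>s @ join N \<delta>s # \<beta>s) \<longleftrightarrow> nested_tuple ((\<gamma>s @ \<delta>s) @ \<beta>s)"
    unfolding
      nested_tuple_append nested_tuple.simps concat.simps concat_append set_append
      Int_Un_distrib Int_Un_distrib2 Un_empty nested_join[OF ne lt] disj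
    by argo
  then show ?thesis unfolding insert unfolding \<alpha>s .
qed

text \<open>Glueing uses one copy of \<open>N\<close> fewer than there are pieces, hence exactly
  \<open>r\<close> copies when \<open>length \<alpha>s = i + 1 + r\<close>.\<close>

lemma count_list_insert_max:
  assumes "length \<alpha>s > i"
  shows "count_list (concat (insert_max N i \<alpha>s \<beta>s)) x =
    count_list (concat \<alpha>s) x + count_list (concat \<beta>s) x + (if x = N then length \<alpha>s - i - 1 else 0)"
proof -
  have "concat \<alpha>s = concat (take i \<alpha>s) @ concat (drop i \<alpha>s)"
    by (metis append_take_drop_id concat_append)
  then show ?thesis
    using assms by (simp add: insert_max_def count_list_join)
qed

lemma upt_split:
  assumes "m \<le> n"
  shows "[Suc 0..<Suc n] = [Suc 0..<Suc m] @ [Suc m..<Suc n]"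
proof -
  have "Suc m + (n - m) = Suc n" using assms by simp
  then show ?thesis
    using upt_add_eq_append[of "Suc 0" "Suc m" "n - m"] by (simp only: Suc_le_mono le0)
qed

text \<open>Before its last letter the final output is the output for \<open>\<alpha>s\<close>
  followed by that for \<open>\<beta>s\<close>. It reads 1, ..., n exactly when the first is 1, ...,
  m and the second is the rest; the letters then form two disjoint intervals and the counts
  separate.\<close>

lemma insert_max_in_sortable_tuples_iff:
  assumes "r \<ge> 1" "i < k" "length \<alpha>s = i + 1 + r" "length \<beta>s = k - 1 - i"
    and lt: "\<forall>x\<in>set (concat \<alpha>s) \<union> set (concat \<beta>s). x < Suc n"
  shows "insert_max (Suc n) i \<alpha>s \<beta>s \<in> sortable_tuples r k 0 (Suc n) \<longleftrightarrow>
    (\<exists>m\<le>n. \<alpha>s \<in> sortable_tuples r (i + 1 + r) 0 m \<and> \<beta>s \<in> sortable_tuples r (k - 1 - i) m (n - m))"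
    (is "?L \<longleftrightarrow> ?R")
proof -
  let ?w = "insert_max (Suc n) i \<alpha>s \<beta>s"
  have le: "length \<alpha>s \<ge> i + 2" "length \<alpha>s > i" using assms by auto
  have len: "length ?w = k" using assms by (simp add: insert_max_def)
  have sort: "stack_sort (stack_sorts ?w) = [Suc 0..<Suc (0 + Suc n)] \<longleftrightarrow>
      stack_sort (stack_sorts \<alpha>s) @ stack_sort (stack_sorts \<beta>s) = [Suc 0..<Suc n]"
    unfolding stack_sorts_insert_max[OF le(1) lt] by simp
  have notin: "Suc n \<notin> set (concat \<alpha>s)" "Suc n \<notin> set (concat \<beta>s)" using lt by blast+
  have "count_list (concat ?w) (Suc n) = r"
    using notin[THEN count_notin] unfolding count_list_insert_max[OF le(2)] by (simp add: assms)
  moreover have "{0<..0 + Suc n} = insert (Suc n) {0<..n}" by auto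
  moreover have "count_list (concat ?w) x = count_list (concat \<alpha>s) x + count_list (concat \<beta>s) x"
    if "x \<in> {0<..n}" for x
    using that unfolding count_list_insert_max[OF le(2)] by simp
  ultimately have count: "(\<forall>x\<in>{0<..0 + Suc n}. count_list (concat ?w) x = r) \<longleftrightarrow>
      (\<forall>x\<in>{0<..n}. count_list (concat \<alpha>s) x + count_list (concat \<beta>s) x = r)"
    by auto
  note mem = sortable_tuples_def mem_Collect_eq len sort count
    nested_tuple_insert_max[OF le(1) lt] nested_tuple_append
  show ?thesis
  proof
    assume L: ?L
    let ?u = "stack_sort (stack_sorts \<alpha>s)" and ?v = "stack_sort (stack_sorts \<beta>s)"
    \<comment> \<open>The position in 1, ..., n at which the first output ends.\<close>
    define m where "m = length ?u"
    have eq: "?u @ ?v = [Suc 0..<Suc n]" using L unfolding mem by blast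
    have mn: "m \<le> n" using arg_cong[OF eq, of length] by (simp add: m_def del: upt_Suc)
    have len_u: "length ?u = length [Suc 0..<Suc m]"
      by (simp add: m_def del: upt_Suc)
    have uv: "?u = [Suc 0..<Suc m]" "?v = [Suc m..<Suc n]"
      using append_eq_append_conv[OF disjI1[OF len_u], THEN iffD1, OF trans[OF eq upt_split[OF mn]]]
      by blast+
    have "set (concat \<alpha>s) = set ?u" "set (concat \<beta>s) = set ?v" by simp_all
    then have sets: "set (concat \<alpha>s) = {0<..m}" "set (concat \<beta>s) = {m<..n}"
      unfolding uv by auto
    have c: "\<forall>x\<in>{0<..n}. count_list (concat \<alpha>s) x + count_list (concat \<beta>s) x = r"
      using L unfolding mem by blast
    \<comment> \<open>Each letter lies in one interval only, so the other summand of its count is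
      zero.\<close>
    have "count_list (concat \<alpha>s) x = r" if "x \<in> {0<..0 + m}" for x
      using c[rule_format, of x] that mn count_notin[of x "concat \<beta>s"] unfolding sets by auto
    moreover have "count_list (concat \<beta>s) x = r" if "x \<in> {m<..m + (n - m)}" for x
      using c[rule_format, of x] that mn count_notin[of x "concat \<alpha>s"] unfolding sets by auto
    moreover have "nested_tuple \<alpha>s" "nested_tuple \<beta>s" using L unfolding mem by blast+
    ultimately show ?R
      using mn uv assms(3,4) unfolding sortable_tuples_def by (intro exI[of _ m]) (simp del: upt_Suc)
  next
    assume ?R
    then obtain m where mn: "m \<le> n" and \<alpha>: "\<alpha>s \<in> sortable_tuples r (i + 1 + r) 0 m"
      and \<beta>: "\<beta>s \<in> sortable_tuples r (k - 1 - i) m (n - m)" by blast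
    have sets: "set (concat \<alpha>s) = {0<..m}" "set (concat \<beta>s) = {m<..n}"
      using sortable_tuplesD[OF \<alpha>] sortable_tuplesD[OF \<beta>] mn by simp_all
    have "stack_sort (stack_sorts \<alpha>s) @ stack_sort (stack_sorts \<beta>s) = [Suc 0..<Suc n]"
      using \<alpha> \<beta> mn unfolding upt_split[OF mn] by (simp add: sortable_tuples_def del: upt_Suc)
    moreover have "count_list (concat \<alpha>s) x + count_list (concat \<beta>s) x = r" if x: "x \<in> {0<..n}" for x
    proof (cases "x \<le> m")
      case True
      then have "x \<notin> set (concat \<beta>s)" unfolding sets by simp
      then show ?thesis using True x \<alpha> by (simp add: sortable_tuples_def count_notin del: set_concat)
    next
      case False
      then have "x \<notin> set (concat \<alpha>s)" unfolding sets by simp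
      then show ?thesis using False x mn \<beta> by (simp add: sortable_tuples_def count_notin del: set_concat)
    qed
    moreover have "set (concat \<alpha>s) \<inter> set (concat \<beta>s) = {}" unfolding sets by auto
    ultimately show ?L
      using \<alpha> \<beta> unfolding mem by (simp del: set_concat upt_Suc)
  qed
qed

text \<open>Disjointness confines the largest letter to one component. Cutting it at the
  \<open>r\<close> copies gives \<open>r + 1\<close> pieces, which are appended to the components
  before it.\<close>

lemma sortable_tuple_cases:
  assumes "r \<ge> 1" "\<omega>s \<in> sortable_tuples r k 0 (Suc n)"
  obtains i \<alpha>s \<beta>s where "i < k" "length \<alpha>s = i + 1 + r" "length \<beta>s = k - 1 - i"
    "\<forall>x\<in>set (concat \<alpha>s) \<union> set (concat \<beta>s). x < Suc n" "\<omega>s = insert_max (Suc n) i \<alpha>s \<beta>s"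
proof -
  let ?N = "Suc n"
  have set: "set (concat \<omega>s) = {0<..0 + ?N}" by (rule sortable_tuplesD[OF assms(2)])
  then have "?N \<in> set (concat \<omega>s)" by simp
  then obtain \<omega> where "\<omega> \<in> set \<omega>s" "?N \<in> set \<omega>" by auto
  then obtain \<gamma>s \<beta>s where \<omega>s: "\<omega>s = \<gamma>s @ \<omega> # \<beta>s" by (meson split_list)
  have nested: "nested_tuple \<omega>s" using assms(2) by (simp add: sortable_tuples_def)
  then have notin: "?N \<notin> set (concat \<gamma>s)" "?N \<notin> set (concat \<beta>s)"
    using \<open>?N \<in> set \<omega>\<close> by (auto simp: \<omega>s nested_tuple_append)
  have "count_list (concat \<omega>s) ?N = r" using assms(2) by (simp add: sortable_tuples_def)
  then have count: "count_list \<omega> ?N = r"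
    using notin[THEN count_notin] by (simp add: \<omega>s)
  define \<alpha>s where "\<alpha>s = \<gamma>s @ split_on ?N \<omega>"
  have "set (concat \<alpha>s) \<union> set (concat \<beta>s) = set (concat \<omega>s) - {?N}"
    using notin by (auto simp: \<omega>s \<alpha>s_def set_concat_split_on simp del: set_concat)
  then have "\<forall>x\<in>set (concat \<alpha>s) \<union> set (concat \<beta>s). x < ?N"
    unfolding set by auto
  moreover have "\<omega>s = insert_max ?N (length \<gamma>s) \<alpha>s \<beta>s"
    by (simp add: insert_max_def \<alpha>s_def \<omega>s join_split_on)
  moreover have "length \<alpha>s = length \<gamma>s + 1 + r"
    by (simp add: \<alpha>s_def length_split_on count)
  moreover have "length \<gamma>s + 1 + length \<beta>s = k"
    using assms(2) by (simp add: sortable_tuples_def \<omega>s)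
  ultimately show ?thesis
    by (intro that[of "length \<gamma>s" \<alpha>s \<beta>s]) auto
qed

text \<open>In both decompositions the distinguished entry is the first one satisfying
  \<open>P\<close>, which determines its position.\<close>

lemma append_Cons_eq_append_Cons_first:
  assumes "xs @ x # ys = us @ w # vs" "P x" "P w" "\<forall>a\<in>set xs. \<not> P a" "\<forall>a\<in>set us. \<not> P a"
  shows "xs = us \<and> x = w \<and> ys = vs"
  using assms
proof (induction xs arbitrary: us)
  case Nil
  then show ?case by (cases us) auto
next
  case (Cons a xs)
  then show ?case by (cases us) auto
qed

text \<open>The position of the component containing \<open>N\<close> gives \<open>i\<close>, and
  cutting this component at \<open>N\<close> returns the pieces. The length bounds ensure that
  \<open>N\<close> occurs in it.\<close>

lemma insert_max_inject:
  assumes "insert_max N i \<alpha>s \<beta>s = insert_max N j \<gamma>s \<delta>s"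
    and "length \<alpha>s \<ge> i + 2" "N \<notin> set (concat \<alpha>s) \<union> set (concat \<beta>s)"
    and "length \<gamma>s \<ge> j + 2" "N \<notin> set (concat \<gamma>s) \<union> set (concat \<delta>s)"
  shows "i = j \<and> \<alpha>s = \<gamma>s \<and> \<beta>s = \<delta>s"
proof -
  have split: "take i \<alpha>s = us \<and> drop i \<alpha>s = split_on N w \<and> \<beta>s = vs"
    if "length \<alpha>s \<ge> i + 2" "N \<notin> set (concat \<alpha>s) \<union> set (concat \<beta>s)"
      "insert_max N i \<alpha>s \<beta>s = us @ w # vs" "N \<in> set w" "N \<notin> set (concat us)"
    for i \<alpha>s \<beta>s us w vs
  proof -
    let ?J = "join N (drop i \<alpha>s)"
    have ne: "drop i \<alpha>s \<noteq> []" "length (drop i \<alpha>s) \<noteq> 1" using that(1) by auto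
    have notin: "N \<notin> set (concat (take i \<alpha>s))" "N \<notin> set (concat (drop i \<alpha>s))"
      using that(2) by (auto dest: in_set_takeD in_set_dropD)
    have "N \<in> set ?J" using ne by (simp add: set_join)
    then have "take i \<alpha>s = us \<and> ?J = w \<and> \<beta>s = vs"
      using that(4,5) notin(1)
      by (intro append_Cons_eq_append_Cons_first[where P = "\<lambda>a. N \<in> set a", OF that(3)[unfolded insert_max_def]])
        auto
    then show ?thesis using split_on_join[OF ne(1) notin(2)] by simp
  qed
  let ?w = "join N (drop j \<gamma>s)"
  have N: "N \<in> set ?w" using assms(4) by (simp add: set_join)
  have N': "N \<notin> set (concat (take j \<gamma>s))" using assms(5) by (auto dest: in_set_takeD)
  have 1: "take i \<alpha>s = take j \<gamma>s \<and> drop i \<alpha>s = split_on N ?w \<and> \<beta>s = \<delta>s"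
    by (rule split[OF assms(2,3) _ N N']) (simp add: assms(1), simp add: insert_max_def)
  \<comment> \<open>Here the second decomposition is compared with itself.\<close>
  have 2: "drop j \<gamma>s = split_on N ?w"
    using split[OF assms(4,5) _ N N'] by (simp add: insert_max_def)
  have "length (take i \<alpha>s) = i" "length (take j \<gamma>s) = j" using assms(2,4) by auto
  then have "i = j" using 1 by metis
  moreover have "\<alpha>s = \<gamma>s" using 1 2 by (metis append_take_drop_id)
  ultimately show ?thesis using 1 by simp
qed

section \<open>The recurrence for the coefficients\<close>

lemma finite_sortable_tuples: "finite (sortable_tuples r k a n)"
proof (rule finite_subset)
  let ?W = "{w. set w \<subseteq> {a<..a+n} \<and> length w \<le> n * r}"
  show "finite {\<alpha>s. set \<alpha>s \<subseteq> ?W \<and> length \<alpha>s = k}"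
    by (intro finite_lists_length_eq finite_lists_length_le) simp
  show "sortable_tuples r k a n \<subseteq> {\<alpha>s. set \<alpha>s \<subseteq> ?W \<and> length \<alpha>s = k}"
  proof
    fix \<alpha>s assume h: "\<alpha>s \<in> sortable_tuples r k a n"
    note set = sortable_tuplesD[OF h]
    have "length (concat \<alpha>s) = (\<Sum>x\<in>{a<..a+n}. count_list (concat \<alpha>s) x)"
      using set by (metis sum_count_set order_refl finite_greaterThanAtMost)
    also have "\<dots> = n * r" using h by (simp add: sortable_tuples_def)
    finally have L: "length (concat \<alpha>s) = n * r" .
    have "set \<alpha> \<subseteq> {a<..a+n} \<and> length \<alpha> \<le> n * r" if \<alpha>: "\<alpha> \<in> set \<alpha>s" for \<alpha>
    proof
      show "set \<alpha> \<subseteq> {a<..a+n}" unfolding set[symmetric] using \<alpha> by auto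
      show "length \<alpha> \<le> n * r"
        unfolding L[symmetric] using \<alpha> by (auto simp: length_concat intro!: member_le_sum_list)
    qed
    then show "\<alpha>s \<in> {\<alpha>s. set \<alpha>s \<subseteq> ?W \<and> length \<alpha>s = k}"
      using h by (auto simp: sortable_tuples_def)
  qed
qed

text \<open>The index \<open>i\<close>, counted from zero, locates the component with the largest
  letter, and \<open>m\<close> counts the letters of the first tuple. \<open>F\<close> maps these
  decompositions bijectively to the tuples on \<open>n + 1\<close> letters.\<close>

lemma p_coeff_Suc:
  assumes "r \<ge> 1"
  shows "p_coeff r k (Suc n) =
    (\<Sum>i<k. \<Sum>m\<le>n. p_coeff r (i + 1 + r) m * p_coeff r (k - 1 - i) (n - m))"
proof -
  define B where "B i m = sortable_tuples r (i + 1 + r) 0 m \<times> sortable_tuples r (k - 1 - i) m (n - m)" for i m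
  define I where "I = (SIGMA i:{..<k}. SIGMA m:{..n}. B i m)"
  define F where "F = (\<lambda>(i, m :: nat, \<alpha>s, \<beta>s). insert_max (Suc n) i \<alpha>s \<beta>s)"
  have card_B: "card (B i m) = p_coeff r (i + 1 + r) m * p_coeff r (k - 1 - i) (n - m)" for i m
    unfolding B_def card_cartesian_product p_coeff_eq_card_sortable_tuples
      card_sortable_tuples_shift[of r "k - 1 - i" m "n - m"] ..
  \<comment> \<open>\<open>F\<close> forgets \<open>m\<close>; injectivity recovers it as the number
    of distinct letters of \<open>\<alpha>s\<close>.\<close>
  have props: "length \<alpha>s = i + 1 + r \<and> length \<beta>s = k - 1 - i \<and>
      (\<forall>x\<in>set (concat \<alpha>s) \<union> set (concat \<beta>s). x < Suc n) \<and> m = card (set (concat \<alpha>s))"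
    if "m \<le> n" "(\<alpha>s, \<beta>s) \<in> B i m" for i m \<alpha>s \<beta>s
  proof -
    have \<alpha>: "\<alpha>s \<in> sortable_tuples r (i + 1 + r) 0 m" and \<beta>: "\<beta>s \<in> sortable_tuples r (k - 1 - i) m (n - m)"
      using that by (auto simp: B_def)
    then show ?thesis
      using that(1) unfolding sortable_tuplesD[OF \<alpha>] sortable_tuplesD[OF \<beta>]
      by (auto simp: sortable_tuples_def)
  qed
  have "inj_on F I"
  proof (rule inj_onI)
    fix a b assume "a \<in> I" "b \<in> I" and eq: "F a = F b"
    then obtain i m \<alpha>s \<beta>s j l \<gamma>s \<delta>s where
      a: "a = (i, m, \<alpha>s, \<beta>s)" "m \<le> n" "(\<alpha>s, \<beta>s) \<in> B i m" and
      b: "b = (j, l, \<gamma>s, \<delta>s)" "l \<le> n" "(\<gamma>s, \<delta>s) \<in> B j l"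
      by (auto simp: I_def)
    note pa = props[OF a(2,3)] and pb = props[OF b(2,3)]
    have "i = j \<and> \<alpha>s = \<gamma>s \<and> \<beta>s = \<delta>s"
    proof (rule insert_max_inject)
      show "insert_max (Suc n) i \<alpha>s \<beta>s = insert_max (Suc n) j \<gamma>s \<delta>s"
        using eq by (simp add: F_def a b)
      show "length \<alpha>s \<ge> i + 2" "length \<gamma>s \<ge> j + 2" using pa pb assms by auto
      show "Suc n \<notin> set (concat \<alpha>s) \<union> set (concat \<beta>s)" "Suc n \<notin> set (concat \<gamma>s) \<union> set (concat \<delta>s)"
        using pa pb by blast+
    qed
    then show "a = b" using pa pb by (simp add: a b)
  qed
  moreover have "F ` I = sortable_tuples r k 0 (Suc n)"
  proof (intro equalityI subsetI)
    fix \<omega>s assume "\<omega>s \<in> F ` I"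
    then obtain i m \<alpha>s \<beta>s where h: "i < k" "m \<le> n" "(\<alpha>s, \<beta>s) \<in> B i m"
      "\<omega>s = insert_max (Suc n) i \<alpha>s \<beta>s"
      by (auto simp: I_def F_def)
    then show "\<omega>s \<in> sortable_tuples r k 0 (Suc n)"
      using props[OF h(2,3)] insert_max_in_sortable_tuples_iff[of r i k \<alpha>s \<beta>s n] assms
      by (auto simp: B_def)
  next
    fix \<omega>s assume \<omega>: "\<omega>s \<in> sortable_tuples r k 0 (Suc n)"
    obtain i \<alpha>s \<beta>s where h: "i < k" "length \<alpha>s = i + 1 + r" "length \<beta>s = k - 1 - i"
      "\<forall>x\<in>set (concat \<alpha>s) \<union> set (concat \<beta>s). x < Suc n" "\<omega>s = insert_max (Suc n) i \<alpha>s \<beta>s"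
      using sortable_tuple_cases[OF assms \<omega>] by metis
    then obtain m where "m \<le> n" "(\<alpha>s, \<beta>s) \<in> B i m"
      using \<omega> insert_max_in_sortable_tuples_iff[OF assms h(1-4)] by (auto simp: B_def)
    then have "(i, m, \<alpha>s, \<beta>s) \<in> I" using h(1) by (simp add: I_def)
    then show "\<omega>s \<in> F ` I" by (rule rev_image_eqI) (simp add: F_def h(5))
  qed
  ultimately have "p_coeff r k (Suc n) = card I"
    unfolding p_coeff_eq_card_sortable_tuples by (metis card_image)
  also have "\<dots> = (\<Sum>i<k. \<Sum>m\<le>n. card (B i m))"
    unfolding I_def by (simp add: card_SigmaI finite_SigmaI B_def finite_sortable_tuples)
  also have "\<dots> = (\<Sum>i<k. \<Sum>m\<le>n. p_coeff r (i + 1 + r) m * p_coeff r (k - 1 - i) (n - m))"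
    unfolding card_B ..
  finally show ?thesis .
qed

lemma p_coeff_0: "p_coeff r k 0 = 1"
proof -
  have nested: "nested_tuple (replicate k [])" by (induction k) auto
  have "sortable_tuples r k 0 0 = {replicate k []}"
  proof (intro equalityI subsetI)
    fix \<alpha>s assume h: "\<alpha>s \<in> sortable_tuples r k 0 0"
    have "length \<alpha>s = k" using h by (simp add: sortable_tuples_def)
    moreover have "\<forall>\<alpha>\<in>set \<alpha>s. \<alpha> = []" using sortable_tuplesD[OF h] by auto
    ultimately show "\<alpha>s \<in> {replicate k []}" by (simp add: replicate_eqI)
  next
    fix \<alpha>s assume "\<alpha>s \<in> {replicate k ([] :: nat list)}"
    then show "\<alpha>s \<in> sortable_tuples r k 0 0"
      using nested by (simp add: sortable_tuples_def)
  qed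
  then show ?thesis by (simp add: p_coeff_eq_card_sortable_tuples)
qed

text \<open>The factor \<open>fps_X\<close> makes coefficient \<open>n\<close> depend only on
  earlier ones. The tuple size \<open>i + 1 + r\<close> may exceed \<open>k\<close>, so the
  induction runs on \<open>n\<close> for all \<open>k\<close> at once.\<close>

lemma p_coeff_unique:
  fixes q :: "nat \<Rightarrow> rat fps"
  assumes "r \<ge> 1" and q: "\<And>k. q k = 1 + fps_X * (\<Sum>i<k. q (i + 1 + r) * q (k - 1 - i))"
  shows "fps_nth (q k) n = of_nat (p_coeff r k n)"
proof (induction n arbitrary: k rule: less_induct)
  case (less n)
  have nth: "fps_nth (q k) n =
    fps_nth (1 + fps_X * (\<Sum>i<k. q (i + 1 + r) * q (k - 1 - i))) n"
    by (subst q) (rule refl)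
  show ?case
  proof (cases n)
    case 0
    then show ?thesis unfolding nth by (simp add: p_coeff_0)
  next
    case (Suc n')
    have "fps_nth (q k) n = (\<Sum>i<k. \<Sum>m=0..n'. fps_nth (q (i + 1 + r)) m * fps_nth (q (k - 1 - i)) (n' - m))"
      using nth unfolding Suc by (simp add: fps_sum_nth fps_mult_nth[of "q _"])
    also have "\<dots> = (\<Sum>i<k. \<Sum>m\<le>n'. of_nat (p_coeff r (i + 1 + r) m * p_coeff r (k - 1 - i) (n' - m)))"
      using less Suc by (intro sum.cong) (auto simp: atMost_atLeast0)
    also have "\<dots> = of_nat (p_coeff r k n)"
      unfolding Suc p_coeff_Suc[OF assms(1)] by simp
    finally show ?thesis .
  qed
qed

section \<open>The functional equation of the closed form\<close>

definition fps_degree_le :: "'a::zero fps \<Rightarrow> nat \<Rightarrow> bool" where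
  "fps_degree_le f n \<longleftrightarrow> (\<forall>k>n. fps_nth f k = 0)"

lemma fps_degree_le_mult:
  fixes f g :: "'a::semiring_0 fps"
  assumes "fps_degree_le f m" "fps_degree_le g n"
  shows "fps_degree_le (f * g) (m + n)"
  unfolding fps_degree_le_def
proof (intro allI impI)
  fix k assume k: "k > m + n"
  have "fps_nth f i * fps_nth g (k - i) = 0" if "i \<in> {0..k}" for i
  proof (cases "i > m")
    case False
    then have "k - i > n" using k by simp
    then show ?thesis using assms(2) by (simp add: fps_degree_le_def)
  qed (use assms(1) in \<open>simp add: fps_degree_le_def\<close>)
  then show "fps_nth (f * g) k = 0" unfolding fps_mult_nth by (rule sum.neutral[rule_format])
qed

lemma fps_degree_le_diff:
  fixes f g :: "'a::group_add fps"
  shows "fps_degree_le f n \<Longrightarrow> fps_degree_le g n \<Longrightarrow> fps_degree_le (f - g) n"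
  by (simp add: fps_degree_le_def)

lemma fps_degree_le_const: "fps_degree_le (fps_const a) n"
  by (simp add: fps_degree_le_def)

lemma fps_degree_le_X_power: "fps_degree_le (fps_X ^ n :: 'a::semiring_1 fps) n"
  by (simp add: fps_degree_le_def fps_X_power_nth)

lemma fps_degree_le_X: "fps_degree_le (fps_X :: 'a::semiring_1 fps) 1"
  using fps_degree_le_X_power[of 1] by simp

lemma fps_degree_le_linear: "fps_degree_le (fps_const a + fps_const b * fps_X :: 'a::semiring_1 fps) 1"
  by (simp add: fps_degree_le_def)

text \<open>Both \<open>v\<close> and \<open>w\<close> are roots of X^2 - (v + w) X + v w, so their
  powers satisfy the corresponding linear recurrence.\<close>

lemma binary_recurrence:
  fixes a b v w :: "'a::comm_ring_1"
  shows "a * v ^ Suc (Suc n) + b * w ^ Suc (Suc n) =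
    (v + w) * (a * v ^ Suc n + b * w ^ Suc n) - v * w * (a * v ^ n + b * w ^ n)"
  by (simp add: algebra_simps)

text \<open>\<open>u\<close> is the reciprocal of c(t): the root of the quadratic equation with
  constant term 1, the other root being \<open>1 - u\<close>.\<close>

lemma c_series_times_half:
  fixes t :: "'a::field_char_0 fps"
  assumes t0: "fps_nth t 0 = 0" and t: "t \<noteq> 0"
  defines "u \<equiv> (1 + sqrt_series (1 - 4 * t)) * fps_const (1/2)"
  shows "c_series t * u = 1" "u * (1 - u) = t" "fps_nth u 0 = 1"
proof -
  define s where "s = sqrt_series (1 - 4 * t)"
  have s: "s ^ 2 = 1 - 4 * t" "fps_nth s 0 = 1"
    using sqrt_series_unique[of "1 - 4 * t" s] t0
    by (simp_all add: s_def fps_mult_nth_0)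
  have "2 * u = (fps_const 2 * fps_const (1/2)) * (1 + s)"
    unfolding u_def s_def[symmetric] numeral_fps_const[symmetric] by (simp only: ac_simps)
  then have u2: "2 * u = 1 + s" by simp
  have "4 * (u * (1 - u)) = 4 * t" using u2 s(1) by algebra
  then show ut: "u * (1 - u) = t" by simp
  show u0: "fps_nth u 0 = 1" using s(2) by (simp add: u_def s_def[symmetric])
  have inv: "inverse u * u = 1" using u0 by (intro inverse_mult_eq_1) simp
  \<comment> \<open>Here 1 - s = 2 (1 - u), and 1 - u = t / u by the quadratic equation. As
    \<open>t\<close> is nonzero, \<open>2 * t\<close> then cancels in the quotient defining
    \<open>c_series\<close>.\<close>
  have "1 - s = (2 * t) * inverse u" using u2 ut inv by algebra
  then have "c_series t = inverse u"
    unfolding c_series_def s_def[symmetric] using t by simp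
  then show "c_series t * u = 1" using inv by simp
qed

text \<open>In the application \<open>a = A r\<close>, \<open>y = (1 + Y) ^ r\<close>,
  \<open>p = (1 + Y) ^ (2 * r + 1)\<close> and \<open>w = z ^ r\<close>. Multiplying the third
  premise by \<open>x * i\<close> turns \<open>p * w\<close> into \<open>w\<close>.\<close>

lemma functional_equation_cancel:
  fixes Q Y a i p x y z w :: "'a::idom"
  assumes "i * Y = 1" "x * p = Y" "(1 - z) * (Q * a) * y = (1 - z) * Y * Q ^ 2 + p * w"
  shows "w * ((1 - z) * Q - 1) = x * ((1 - z) * (Q * (Q - (i * (y * a) - i * p * w))))"
  using assms by algebra

text \<open>The scalars \<open>\<eta>\<close> and \<open>\<xi>\<close> stand for the series \<open>y\<close> and \<open>x\<close>, which are constants with respect to \<open>z\<close>.\<close>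

locale catalytic =
  fixes \<eta> \<xi> :: "'a::field_char_0" and r :: nat and Y z u u' v v' :: "'a fps"
  assumes \<eta>: "\<eta> \<noteq> 0" "1 + \<eta> \<noteq> 0" and \<xi>: "\<xi> * (1 + \<eta>) ^ (2 * r + 1) = \<eta>"
    and Y: "Y = fps_const \<eta>" and z: "z = fps_X"
    and u: "u + u' = 1" "u * u' * (1 - z) = Y * (1 + Y) * z" and u0: "fps_nth u 0 = 1"
    and v: "v * (u + Y) = u" "v' * (u' + Y) = u'"
begin

abbreviation "D \<equiv> (u + Y) * (u' + Y)"

lemma u'_eq: "u' = 1 - u"
  using u(1) by (simp add: algebra_simps)

lemma nonzero: "u + Y \<noteq> 0" "u' + Y \<noteq> 0" "1 + Y \<noteq> 0" "Y \<noteq> 0"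
proof -
  have "fps_nth (u + Y) 0 \<noteq> 0" "fps_nth (u' + Y) 0 \<noteq> 0" "fps_nth (1 + Y) 0 \<noteq> 0" "fps_nth Y 0 \<noteq> 0"
    using \<eta> u0 by (simp_all add: Y u'_eq)
  then show "u + Y \<noteq> 0" "u' + Y \<noteq> 0" "1 + Y \<noteq> 0" "Y \<noteq> 0"
    by (metis fps_zero_nth)+
qed

lemma D_eq: "D = u * u' + Y * (1 + Y)"
  by (simp add: u'_eq algebra_simps)

lemma z_D: "z * D = u * u'"
  using u(2) unfolding D_eq by algebra

lemma one_minus_z_D: "(1 - z) * D = Y * (1 + Y)"
  using z_D D_eq by (simp add: algebra_simps)

lemma v_v': "v * v' = z"
proof -
  have "v * v' * D = (v * (u + Y)) * (v' * (u' + Y))"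
    by (simp only: ac_simps)
  also have "\<dots> = z * D"
    unfolding v z_D ..
  finally have "v * v' * D = z * D" .
  then show ?thesis using nonzero by simp
qed

text \<open>Over the common denominator \<open>D\<close> the numerator is symmetric in
  \<open>u\<close> and \<open>u'\<close>, so it is determined by \<open>u + u' = 1\<close> and
  \<open>u * u' = z * D\<close>.\<close>

lemma v_plus_v': "(1 + Y) * (v + v') = 1 + (1 + 2 * Y) * z"
proof -
  have "(1 + Y) * (v + v') * D = (1 + Y) * (v * (u + Y) * (u' + Y) + v' * (u' + Y) * (u + Y))"
    by (simp add: algebra_simps)
  also have "\<dots> = (1 + Y) * (u * (u' + Y) + u' * (u + Y))"
    unfolding v ..
  also have "\<dots> = (1 + Y) * (2 * (u * u') + Y)"
    by (simp add: u'_eq algebra_simps)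
  also have "\<dots> = D + (1 + 2 * Y) * (z * D)"
    unfolding z_D unfolding D_eq by (simp add: algebra_simps)
  also have "\<dots> = (1 + (1 + 2 * Y) * z) * D"
    by (simp add: algebra_simps)
  finally show ?thesis using nonzero by simp
qed

text \<open>Exchanging \<open>u\<close> and \<open>u'\<close>, the two signs of the square root,
  exchanges the summands, so the root disappears from the sum. For \<open>n = r\<close> the first
  summand is the closed form up to the constant factor \<open>(1 + Y) ^ r / Y\<close>.\<close>

definition A :: "nat \<Rightarrow> 'a fps" where
  "A n = (u' + Y) * v ^ n + (u + Y) * v' ^ n"

lemma A_0: "A 0 = 1 + 2 * Y"
proof -
  have "A 0 = (u + u') + 2 * Y" by (simp add: A_def)
  then show ?thesis unfolding u(1) .
qed

lemma A_1: "(1 + Y) * A 1 = Y + (1 + 2 * Y) ^ 2 * z"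
proof -
  \<comment> \<open>The full product of the sums contains the wanted cross terms and the diagonal
    ones, which add up to \<open>u + u' = 1\<close>.\<close>
  have "A 1 = (u + u' + 2 * Y) * (v + v') - (v * (u + Y) + v' * (u' + Y))"
    by (simp add: A_def algebra_simps)
  also have "\<dots> = (1 + 2 * Y) * (v + v') - 1"
    unfolding v u by (simp add: algebra_simps)
  finally have "(1 + Y) * A 1 = (1 + 2 * Y) * ((1 + Y) * (v + v')) - (1 + Y)"
    by algebra
  then show ?thesis
    unfolding v_plus_v' by algebra
qed

lemma A_Suc_Suc: "A (Suc (Suc n)) = (v + v') * A (Suc n) - z * A n"
  unfolding A_def v_v'[symmetric] by (rule binary_recurrence)

lemma inverse_one_plus_Y: "fps_const (1 / (1 + \<eta>)) * (1 + Y) = 1"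
proof -
  have "1 + Y = fps_const (1 + \<eta>)" by (simp add: Y flip: fps_const_add)
  then show ?thesis using \<eta> by simp
qed

text \<open>Induction along the recurrence, which multiplies by \<open>v + v'\<close> and by
  \<open>z\<close>, both of degree at most one.\<close>

lemma degree_A: "fps_degree_le (A n) n"
proof -
  have cancel: "f = fps_const (1 / (1 + \<eta>)) * ((1 + Y) * f)" for f
    using inverse_one_plus_Y by (metis mult.assoc mult_1)
  \<comment> \<open>\<open>1 + Y\<close> is a nonzero constant with respect to \<open>z\<close>, so
    dividing by it keeps the degree.\<close>
  have lin: "fps_degree_le f 1"
    if "(1 + Y) * f = fps_const a + fps_const b * fps_X" for f a b
    using fps_degree_le_mult[OF fps_degree_le_const[of "1 / (1 + \<eta>)" 0]
        fps_degree_le_linear[of a b]] that cancel[of f] by simp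
  have "1 + (1 + 2 * Y) * z = fps_const 1 + fps_const (1 + 2 * \<eta>) * fps_X"
    by (simp add: Y z fps_numeral_fps_const flip: fps_const_add)
  then have vv': "fps_degree_le (v + v') 1"
    using lin v_plus_v' by metis
  have "Y + (1 + 2 * Y) ^ 2 * z = fps_const \<eta> + fps_const ((1 + 2 * \<eta>) ^ 2) * fps_X"
    by (simp add: Y z fps_numeral_fps_const flip: fps_const_add fps_const_power)
  then have A1: "fps_degree_le (A 1) 1"
    using lin A_1 by metis
  have "1 + 2 * Y = fps_const (1 + 2 * \<eta>)"
    by (simp add: Y fps_numeral_fps_const flip: fps_const_add)
  then have A0: "fps_degree_le (A 0) 0"
    by (simp only: A_0 fps_degree_le_const)
  show ?thesis
  proof (induction n rule: induct_nat_012)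
    case (ge2 n)
    have "fps_degree_le (z * A n) (Suc (Suc n))"
      using fps_degree_le_mult[OF fps_degree_le_X ge2(1)] by (auto simp: z fps_degree_le_def)
    moreover have "fps_degree_le ((v + v') * A (Suc n)) (Suc (Suc n))"
      using fps_degree_le_mult[OF vv' ge2(2)] by simp
    ultimately show ?case
      unfolding A_Suc_Suc by (intro fps_degree_le_diff)
  qed (use A0 A1 in simp_all)
qed

section \<open>The closed form and its functional equation\<close>

context
  fixes Q :: "'a fps"
  assumes Q: "Q * ((1 - z) * (u + Y)) = (1 + Y) ^ (r + 1) * v ^ r"
begin

text \<open>The first summand of \<open>A r\<close> is a multiple of \<open>Q\<close>, so its
  product with \<open>Q\<close> is a multiple of \<open>Q ^ 2\<close>. In the product with the
  second summand the powers of \<open>v\<close> and \<open>v'\<close> combine to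
  \<open>z ^ r\<close>.\<close>

lemma Q_A:
  "(1 - z) * (Q * A r) * (1 + Y) ^ r = (1 - z) * Y * Q ^ 2 + (1 + Y) ^ (2 * r + 1) * z ^ r"
proof -
  let ?y = "1 + Y"
  have 1: "(1 - z) * (Q * ((u + Y) * v' ^ r)) = ?y ^ (r + 1) * z ^ r"
  proof -
    have "(1 - z) * (Q * ((u + Y) * v' ^ r)) = Q * ((1 - z) * (u + Y)) * v' ^ r"
      by (simp only: ac_simps)
    also have "\<dots> = ?y ^ (r + 1) * (v * v') ^ r"
      unfolding Q power_mult_distrib by (simp only: ac_simps)
    finally show ?thesis unfolding v_v' .
  qed
  have 2: "(1 - z) * (Q * ((u' + Y) * v ^ r)) * ?y ^ r = (1 - z) * Y * Q ^ 2"
  proof -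
    \<comment> \<open>The extra factor \<open>1 + Y\<close> completes the power in the equation for
      \<open>Q\<close> and is cancelled at the end.\<close>
    have "(1 - z) * (Q * ((u' + Y) * v ^ r)) * ?y ^ r * ?y
        = (1 - z) * Q * (u' + Y) * (?y ^ (r + 1) * v ^ r)"
      by (simp only: power_add power_one_right ac_simps)
    also have "\<dots> = (1 - z) * Q ^ 2 * ((1 - z) * D)"
      unfolding Q[symmetric] by algebra
    also have "\<dots> = (1 - z) * Y * Q ^ 2 * ?y"
      unfolding one_minus_z_D by algebra
    finally show ?thesis using nonzero by simp
  qed
  have "(1 - z) * (Q * A r) * ?y ^ r =
      (1 - z) * (Q * ((u' + Y) * v ^ r)) * ?y ^ r + (1 - z) * (Q * ((u + Y) * v' ^ r)) * ?y ^ r"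
    by (simp add: A_def algebra_simps)
  also have "\<dots> = (1 - z) * Y * Q ^ 2 + ?y ^ (r + 1) * z ^ r * ?y ^ r"
    unfolding 1 2 ..
  also have "?y ^ (r + 1) * z ^ r * ?y ^ r = ?y ^ (2 * r + 1) * z ^ r"
    by (simp add: mult_2 power_add)
  finally show ?thesis .
qed

lemma Q_0: "fps_nth Q 0 = 1"
proof -
  have "fps_nth v 0 * (1 + \<eta>) = 1"
    using arg_cong[OF v(1), of "\<lambda>f. fps_nth f 0"] u0 by (simp add: Y)
  then have v0: "fps_nth v 0 = 1 / (1 + \<eta>)"
    using \<eta> by (simp add: field_simps)
  have "fps_nth Q 0 * (1 + \<eta>) = (1 + \<eta>) ^ (r + 1) * (1 / (1 + \<eta>)) ^ r"
    using arg_cong[OF Q, of "\<lambda>f. fps_nth f 0"] u0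
    by (simp add: Y z fps_power_zeroth v0)
  also have "\<dots> = 1 + \<eta>" using \<eta> by (simp add: power_divide)
  finally show ?thesis using \<eta> by simp
qed

lemma functional_equation:
  "(1 - z) * Q = 1 + fps_const \<xi> * ((1 - z) * (Q * (z * fps_shift (r + 1) Q)))"
proof -
  let ?y = "1 + Y" and ?x = "fps_const \<xi>" and ?i = "fps_const (1 / \<eta>)"
  have x: "?x * ?y ^ (2 * r + 1) = Y"
  proof -
    have "?y = fps_const (1 + \<eta>)" by (simp add: Y flip: fps_const_add)
    then show ?thesis using \<xi> by (simp only: Y fps_const_power fps_const_mult)
  qed
  have i: "?i * Y = 1" using \<eta> by (simp add: Y)
  \<comment> \<open>The polynomial supplied by \<open>functional_equation_cancel\<close>.\<close>
  define T where "T = ?i * (?y ^ r * A r) - ?i * ?y ^ (2 * r + 1) * z ^ r"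
  have degT: "fps_degree_le T r"
  proof -
    have y: "?y = fps_const (1 + \<eta>)" by (simp add: Y flip: fps_const_add)
    have c: "fps_degree_le (fps_const a * f) r" if "fps_degree_le f r" for a :: 'a and f
      using fps_degree_le_mult[OF fps_degree_le_const[of a 0] that] by simp
    show ?thesis
      unfolding T_def y z mult.assoc fps_const_power
      by (intro fps_degree_le_diff c degree_A fps_degree_le_X_power)
  qed
  have eq: "z ^ r * ((1 - z) * Q - 1) = ?x * ((1 - z) * (Q * (Q - T)))"
  proof -
    show ?thesis
      unfolding T_def by (rule functional_equation_cancel[OF i x Q_A])
  qed
  have \<xi>0: "\<xi> \<noteq> 0" using \<xi> \<eta> by auto
  \<comment> \<open>The factor \<open>?g\<close> is invertible, and the left-hand side of
    \<open>eq\<close> is divisible by \<open>z ^ (r + 1)\<close> because \<open>(1 - z) * Q\<close>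
    has constant term 1.\<close>
  have low: "fps_nth (Q - T) j = 0" if "j \<le> r" for j
  proof -
    let ?g = "?x * ((1 - z) * Q)"
    have g0: "fps_nth ?g 0 \<noteq> 0" using \<xi>0 Q_0 by (simp add: z)
    define h where "h = fps_shift 1 ((1 - z) * Q - 1)"
    have "fps_nth ((1 - z) * Q - 1) 0 = 0" using Q_0 by (simp add: z)
    then have h: "(1 - z) * Q - 1 = fps_X * h"
      unfolding h_def by (intro fps_ext) (simp add: fps_X_mult_nth del: fps_sub_nth)
    have "Q - T = inverse ?g * ?g * (Q - T)"
      using inverse_mult_eq_1[OF g0] by simp
    also have "\<dots> = inverse ?g * (z ^ r * ((1 - z) * Q - 1))"
      unfolding eq by (simp only: ac_simps)
    also have "\<dots> = fps_X ^ (r + 1) * (inverse ?g * h)"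
      unfolding h unfolding z by (simp add: ac_simps)
    finally show ?thesis
      using that by (simp only: fps_X_power_mult_nth) simp
  qed
  \<comment> \<open>Coefficients up to \<open>r\<close> vanish by \<open>low\<close>; beyond
    \<open>r\<close> the polynomial \<open>T\<close> contributes nothing.\<close>
  have "Q - T = fps_X ^ (r + 1) * fps_shift (r + 1) Q"
  proof (rule fps_ext)
    fix k show "fps_nth (Q - T) k = fps_nth (fps_X ^ (r + 1) * fps_shift (r + 1) Q) k"
    proof (cases "k \<le> r")
      case True
      then show ?thesis using low[of k] unfolding fps_X_power_mult_nth by simp
    next
      case False
      then show ?thesis using degT unfolding fps_X_power_mult_nth fps_degree_le_def by simp
    qed
  qed
  then have "z ^ r * ((1 - z) * Q - 1) = z ^ r * (?x * ((1 - z) * (Q * (z * fps_shift (r + 1) Q))))"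
    unfolding eq by (simp add: z ac_simps)
  then have "(1 - z) * Q - 1 = ?x * ((1 - z) * (Q * (z * fps_shift (r + 1) Q)))"
    by (simp add: z)
  then show ?thesis by (simp add: algebra_simps)
qed

end

end

section \<open>Coefficients that are power series in x\<close>

text \<open>The closed form is computed over Laurent series, but the recurrence is solved uniquely
  over power series in x. Hence its coefficients must be shown to have no negative powers of
  x.\<close>

definition integral_coeffs :: "'a::field fls fps \<Rightarrow> bool" where
  "integral_coeffs f \<longleftrightarrow> (\<forall>k. fps_nth f k \<in> range fps_to_fls)"

lemma range_fps_to_fls_closed:
  fixes a b :: "'a::field fls"
  assumes "a \<in> range fps_to_fls" "b \<in> range fps_to_fls"
  shows "a + b \<in> range fps_to_fls" "a * b \<in> range fps_to_fls" "- a \<in> range fps_to_fls"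
proof -
  obtain f g where "a = fps_to_fls f" "b = fps_to_fls g" using assms by blast
  then have "a + b = fps_to_fls (f + g)" "a * b = fps_to_fls (f * g)" "- a = fps_to_fls (- f)"
    by (simp_all add: fls_times_fps_to_fls)
  then show "a + b \<in> range fps_to_fls" "a * b \<in> range fps_to_fls" "- a \<in> range fps_to_fls"
    by blast+
qed

lemma range_fps_to_fls_0: "(0 :: 'a::field fls) \<in> range fps_to_fls"
  by (rule range_eqI[of _ _ 0]) simp

lemma range_fps_to_fls_1: "(1 :: 'a::field fls) \<in> range fps_to_fls"
  by (rule range_eqI[of _ _ 1]) simp

lemma range_fps_to_fls_sum:
  "(\<And>i. i \<in> A \<Longrightarrow> f i \<in> range fps_to_fls) \<Longrightarrow> (sum f A :: 'a::field fls) \<in> range fps_to_fls"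
  by (induction A rule: infinite_finite_induct)
    (auto simp only: sum.infinite sum.empty sum.insert range_fps_to_fls_0 range_fps_to_fls_closed insert_iff simp_thms)

lemma integral_coeffs_add: "integral_coeffs f \<Longrightarrow> integral_coeffs g \<Longrightarrow> integral_coeffs (f + g)"
  unfolding integral_coeffs_def fps_add_nth by (intro allI range_fps_to_fls_closed) blast+

lemma integral_coeffs_const: "a \<in> range fps_to_fls \<Longrightarrow> integral_coeffs (fps_const a)"
  unfolding integral_coeffs_def by (simp only: fps_nth_fps_const range_fps_to_fls_0 split: if_split) blast

lemma integral_coeffs_1: "integral_coeffs 1"
  using integral_coeffs_const[OF range_fps_to_fls_1] by simp

lemma integral_coeffs_mult:
  "integral_coeffs f \<Longrightarrow> integral_coeffs g \<Longrightarrow> integral_coeffs (f * g)"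
  unfolding integral_coeffs_def fps_mult_nth
  by (intro allI range_fps_to_fls_sum range_fps_to_fls_closed) blast+

lemma integral_coeffs_power: "integral_coeffs f \<Longrightarrow> integral_coeffs (f ^ n)"
  by (induction n) (simp_all add: integral_coeffs_1 integral_coeffs_mult)

text \<open>The recursion for the coefficients of the inverse divides only by the constant
  coefficient.\<close>

lemma integral_coeffs_inverse:
  assumes f: "integral_coeffs f" and f0: "inverse (fps_nth f 0) \<in> range fps_to_fls"
  shows "integral_coeffs (inverse f)"
proof -
  have "fps_nth (inverse f) n \<in> range fps_to_fls" for n
  proof (induction n rule: less_induct)
    case (less n)
    show ?case
    proof (cases n)
      case 0
      then show ?thesis using f0 by simp
    next
      case (Suc k)
      have "fps_nth (inverse f) n =
          - inverse (fps_nth f 0) * (\<Sum>i=1..n. fps_nth f i * fps_nth (inverse f) (n - i))"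
        by (simp only: fps_inverse_def Suc fps_nth_Abs_fps fps_right_inverse_constructor.simps)
      also have "\<dots> \<in> range fps_to_fls"
        using less f f0 unfolding integral_coeffs_def
        by (intro range_fps_to_fls_closed range_fps_to_fls_sum) auto
      finally show ?thesis .
    qed
  qed
  then show ?thesis by (simp add: integral_coeffs_def)
qed

text \<open>As \<open>t\<close> has zero constant term, coefficient \<open>n\<close> of
  \<open>t * c ^ 2\<close> uses only coefficients of \<open>c\<close> below \<open>n\<close>. Unlike
  the quotient by \<open>2 * t\<close>, this involves no division.\<close>

lemma integral_coeffs_quadratic:
  assumes c: "c = 1 + t * c ^ 2" and t: "integral_coeffs t" "fps_nth t 0 = 0"
  shows "integral_coeffs c"
proof -
  have "fps_nth c n \<in> range fps_to_fls" for n
  proof (induction n rule: less_induct)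
    case (less n)
    have sq: "fps_nth (c ^ 2) m \<in> range fps_to_fls" if "m < n" for m
      unfolding power2_eq_square fps_mult_nth
      using less that by (intro range_fps_to_fls_sum range_fps_to_fls_closed) auto
    have "fps_nth t i * fps_nth (c ^ 2) (n - i) \<in> range fps_to_fls" if "i \<in> {0..n}" for i
    proof (cases "i = 0")
      case True
      then show ?thesis using t(2) range_fps_to_fls_0 by simp
    next
      case False
      then have "n - i < n" using that by simp
      then show ?thesis using t(1) sq unfolding integral_coeffs_def
        by (intro range_fps_to_fls_closed) blast+
    qed
    then have "fps_nth (t * c ^ 2) n \<in> range fps_to_fls"
      unfolding fps_mult_nth by (rule range_fps_to_fls_sum)
    moreover have "fps_nth (1 :: 'a fls fps) n \<in> range fps_to_fls"
      using integral_coeffs_1 unfolding integral_coeffs_def by blast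
    ultimately have "fps_nth (1 + t * c ^ 2) n \<in> range fps_to_fls"
      unfolding fps_add_nth by (intro range_fps_to_fls_closed)
    then show ?case unfolding c[symmetric] .
  qed
  then show ?thesis by (simp add: integral_coeffs_def)
qed

section \<open>Identification of the generating function with the closed form\<close>

theorem theorem7:
  fixes r :: nat and y :: "rat fps" and Y z t :: "rat fls fps"
  assumes "r \<ge> 1"
    and "fps_nth y 0 = 0"
    and "fps_X = y / (1 + y) ^ (2 * r + 1)"
    and "Y = x_series y"
    and "z = fps_X"
    and "t = Y * (1 + Y) * (z / (1 - z))"
  shows "P_series r =
    (1 + t / (Y * (1 + Y))) *
      (c_series t * (1 + Y) ^ (r + 1) / (1 + Y * c_series t) ^ (r + 1))"
proof -
  define \<eta> \<xi> where "\<eta> = fps_to_fls y" and "\<xi> = fps_to_fls (fps_X :: rat fps)"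
  define w where "w = inverse (1 - z)"
  define c where "c = c_series t"
  have y1: "fps_nth (1 + y) 0 = 1" using assms(2) by simp
  have y_power: "fps_nth ((1 + y) ^ (2 * r + 1)) 0 \<noteq> 0"
    using y1 by (simp only: fps_power_zeroth) simp
  have xy: "fps_X * (1 + y) ^ (2 * r + 1) = y"
    by (subst assms(3)) (simp only: fps_divide_unit[OF y_power] mult.assoc inverse_mult_eq_1[OF y_power] mult_1_right)
  have one_plus_\<eta>: "1 + \<eta> = fps_to_fls (1 + y)" by (simp add: \<eta>_def)
  have "1 + y \<noteq> 0" using y1 by (metis fps_zero_nth zero_neq_one)
  then have \<eta>1: "1 + \<eta> \<noteq> 0" unfolding one_plus_\<eta> by (simp only: fps_to_fls_eq_0_iff not_False_eq_True)
  have "y \<noteq> 0" using xy \<open>1 + y \<noteq> 0\<close> by (metis fps_X_neq_zero mult_eq_0_iff power_not_zero)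
  then have \<eta>0: "\<eta> \<noteq> 0" by (simp add: \<eta>_def)
  have \<xi>: "\<xi> * (1 + \<eta>) ^ (2 * r + 1) = \<eta>"
    unfolding one_plus_\<eta> using arg_cong[OF xy, of fps_to_fls]
    by (simp only: \<xi>_def \<eta>_def fls_times_fps_to_fls fps_to_fls_power)
  have Y: "Y = fps_const \<eta>" by (simp add: assms(4) x_series_def \<eta>_def)
  have Y1: "1 + Y = fps_const (1 + \<eta>)" by (simp add: Y flip: fps_const_add)
  have nz: "Y * (1 + Y) \<noteq> 0" using \<eta>0 \<eta>1 unfolding Y1 unfolding Y by simp
  have w: "w * (1 - z) = 1" unfolding w_def assms(5) by (intro inverse_mult_eq_1) simp
  have w_nth: "fps_nth w k = 1" for k
    unfolding w_def assms(5) using fps_inverse_one_minus_fps_X by (metis fps_nth_Abs_fps)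
  have zw: "z / (1 - z) = z * w" unfolding w_def by (rule fps_divide_unit) (simp add: assms(5))
  have t: "t = Y * (1 + Y) * (z * w)" unfolding assms(6) zw ..
  have t0: "fps_nth t 0 = 0" by (simp add: t assms(5))
  have "z * w \<noteq> 0" using w by (auto simp: assms(5))
  then have tn: "t \<noteq> 0" using nz t by simp
  \<comment> \<open>The divisor is a nonzero element of the coefficient field, so the cancellation
    is genuine.\<close>
  have "t / (Y * (1 + Y)) = z * w"
    unfolding t using nz by (rule nonzero_mult_div_cancel_left)
  moreover have "1 + z * w = w" using w by algebra
  ultimately have w_eq: "1 + t / (Y * (1 + Y)) = w" by simp
  obtain u where cu: "c * u = 1" "u * (1 - u) = t" "fps_nth u 0 = 1"
    using c_series_times_half[OF t0 tn] unfolding c_def by blast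
  define u' where "u' = 1 - u"
  define v v' where "v = u * inverse (u + Y)" and "v' = u' * inverse (u' + Y)"
  \<comment> \<open>The constant terms are \<open>1 + \<eta>\<close> and \<open>\<eta>\<close>; the
    latter is invertible because the coefficients are Laurent series.\<close>
  have inv: "inverse (u + Y) * (u + Y) = 1" "inverse (u' + Y) * (u' + Y) = 1"
    using cu(3) \<eta>0 \<eta>1 by (intro inverse_mult_eq_1; simp add: Y u'_def)+
  interpret catalytic \<eta> \<xi> r Y z u u' v v'
  proof
    show "u * u' * (1 - z) = Y * (1 + Y) * z"
      using cu(2) w unfolding u'_def t by algebra
    show "v * (u + Y) = u" "v' * (u' + Y) = u'"
      unfolding v_def v'_def mult.assoc inv by simp_all
  qed (use \<eta>0 \<eta>1 \<xi> Y assms(5) cu in \<open>simp_all add: u'_def\<close>)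
  define e where "e = 1 + Y * c"
  have ce: "e = c * (u + Y)" using cu(1) unfolding e_def by algebra
  have c0: "fps_nth c 0 = 1"
    using arg_cong[OF cu(1), of "\<lambda>f. fps_nth f 0"] cu(3) by simp
  have e0: "fps_nth e 0 = 1 + \<eta>" using c0 by (simp add: e_def Y)
  \<comment> \<open>The right-hand side, with its first factor replaced by the geometric series
    \<open>w\<close> and the division by an inverse.\<close>
  define Q where "Q = w * (c * (1 + Y) ^ (r + 1) * inverse e ^ (r + 1))"
  have e_inv: "inverse e * e = 1" using e0 \<eta>1 by (intro inverse_mult_eq_1) simp
  have e_power: "fps_nth (e ^ (r + 1)) 0 \<noteq> 0" using e0 \<eta>1 by (simp add: fps_power_zeroth)
  have RHS: "(1 + t / (Y * (1 + Y))) * (c_series t * (1 + Y) ^ (r + 1) / (1 + Y * c_series t) ^ (r + 1)) = Q"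
    unfolding w_eq Q_def c_def[symmetric] e_def[symmetric] fps_divide_unit[OF e_power] fps_inverse_power ..
  have Q_eq: "Q * ((1 - z) * (u + Y)) = (1 + Y) ^ (r + 1) * v ^ r"
  proof -
    have ie: "inverse e * (u + Y) = u"
      using e_inv cu(1) ce by algebra
    \<comment> \<open>Since \<open>e = c * (u + Y)\<close> and \<open>c\<close> is the reciprocal of
      \<open>u\<close>, inverting \<open>e\<close> gives u / (u + Y).\<close>
    have "inverse e = v"
    proof -
      have "inverse e * (u + Y) = v * (u + Y)" unfolding ie v(1) ..
      then show ?thesis using nonzero(1) by simp
    qed
    then have "Q * ((1 - z) * (u + Y)) = (w * (1 - z)) * (c * (v * (u + Y))) * ((1 + Y) ^ (r + 1) * v ^ r)"
      unfolding Q_def by (simp add: ac_simps)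
    then show ?thesis unfolding w v(1) cu(1) by simp
  qed
  have int_Y: "integral_coeffs Y" unfolding Y \<eta>_def by (intro integral_coeffs_const rangeI)
  have int_w: "integral_coeffs w" unfolding integral_coeffs_def w_nth using range_fps_to_fls_1 by blast
  have int_z: "integral_coeffs z"
    unfolding integral_coeffs_def assms(5) fps_X_nth using range_fps_to_fls_0 range_fps_to_fls_1 by auto
  have "integral_coeffs Q"
  proof -
    have int_t: "integral_coeffs t"
      unfolding t by (intro integral_coeffs_mult integral_coeffs_add integral_coeffs_1 int_Y int_w int_z)
    \<comment> \<open>The quadratic equation for \<open>u\<close>, multiplied by
      \<open>c ^ 2\<close>.\<close>
    have "c = 1 + t * c ^ 2" using cu(1,2) by algebra
    then have int_c: "integral_coeffs c" using int_t t0 by (rule integral_coeffs_quadratic)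
    \<comment> \<open>\<open>1 + y\<close> has constant term 1, so it is invertible already as a
      power series in x.\<close>
    have "inverse (fps_nth e 0) = fps_to_fls (inverse (1 + y))"
      unfolding e0 one_plus_\<eta> using y1 by (intro fls_inverse_fps_to_fls subdegree_eq_0) simp
    then have "inverse (fps_nth e 0) \<in> range fps_to_fls" by blast
    moreover have "integral_coeffs e"
      unfolding e_def by (intro integral_coeffs_add integral_coeffs_mult integral_coeffs_1 int_Y int_c)
    ultimately have "integral_coeffs (inverse e)" by (intro integral_coeffs_inverse)
    then show ?thesis unfolding Q_def
      by (intro integral_coeffs_mult integral_coeffs_power integral_coeffs_add integral_coeffs_1 int_Y int_w int_c)
  qed
  then obtain q where q: "\<And>k. fps_nth Q k = fps_to_fls (q k)"
    unfolding integral_coeffs_def image_iff by metis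
  \<comment> \<open>The functional equation multiplied by \<open>w\<close>, the inverse of
    \<open>1 - z\<close>.\<close>
  have Q_fixed: "Q = w + fps_const \<xi> * (z * (fps_shift (r + 1) Q * Q))"
  proof -
    let ?S = "z * (fps_shift (r + 1) Q * Q)"
    have "Q = (w * (1 - z)) * Q" unfolding w by simp
    also have "\<dots> = w * ((1 - z) * Q)" by (rule mult.assoc)
    also have "\<dots> = w + fps_const \<xi> * ((w * (1 - z)) * ?S)"
      unfolding functional_equation[OF Q_eq] by (simp only: distrib_left mult_1_right mult_1_left ac_simps)
    finally show ?thesis unfolding w mult_1_left .
  qed
  have Q_nth: "fps_nth Q k = 1 + \<xi> * (\<Sum>i<k. fps_nth Q (i + 1 + r) * fps_nth Q (k - 1 - i))" for k
  proof -
    \<comment> \<open>The factor \<open>z\<close> lowers the total index to \<open>k - 1\<close>,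
      and the shift raises the first index by \<open>r + 1\<close>; for \<open>k = 0\<close> both
      sides are zero.\<close>
    have "fps_nth (z * (fps_shift (r + 1) Q * Q)) k = (\<Sum>i<k. fps_nth Q (i + 1 + r) * fps_nth Q (k - 1 - i))"
    proof (cases k)
      case (Suc k')
      have "fps_nth (z * (fps_shift (r + 1) Q * Q)) k = fps_nth (fps_shift (r + 1) Q * Q) k'"
        unfolding assms(5) Suc by simp
      also have "\<dots> = (\<Sum>i=0..k'. fps_nth Q (i + (r + 1)) * fps_nth Q (k' - i))"
        by (simp only: fps_mult_nth fps_shift_nth)
      also have "\<dots> = (\<Sum>i<k. fps_nth Q (i + 1 + r) * fps_nth Q (k - 1 - i))"
        unfolding Suc by (intro sum.cong) (auto simp: add.commute add.left_commute)
      finally show ?thesis .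
    qed (simp add: assms(5))
    moreover have "fps_nth Q k = fps_nth (w + fps_const \<xi> * (z * (fps_shift (r + 1) Q * Q))) k"
      using Q_fixed by (rule arg_cong)
    ultimately show ?thesis
      by (simp only: fps_add_nth fps_mult_left_const_nth w_nth)
  qed
  have sum_fls: "fps_to_fls (sum f A) = (\<Sum>i\<in>A. fps_to_fls (f i))" for f :: "nat \<Rightarrow> rat fps" and A
    by (induction A rule: infinite_finite_induct) simp_all
  \<comment> \<open>Injectivity of the embedding brings the recurrence down to power series in
    x.\<close>
  have "fps_to_fls (q k) = fps_to_fls (1 + fps_X * (\<Sum>i<k. q (i + 1 + r) * q (k - 1 - i)))" for k
    using Q_nth[of k] unfolding q \<xi>_def
    by (simp only: fps_to_fls_plus fls_times_fps_to_fls sum_fls fps_one_to_fls)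
  then have "q k = 1 + fps_X * (\<Sum>i<k. q (i + 1 + r) * q (k - 1 - i))" for k
    by (rule fps_to_fls_eq_imp_fps_eq)
  then have "fps_nth (q k) n = of_nat (p_coeff r k n)" for k n
    by (rule p_coeff_unique[OF assms(1)])
  then have "q k = Abs_fps (\<lambda>n. of_nat (p_coeff r k n))" for k
    by (intro fps_ext) simp
  then have "P_series r = Q"
    by (intro fps_ext) (simp add: P_series_def q)
  then show ?thesis unfolding RHS .
qed

end
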